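(* Let $f:\mathbb{R}^n\to\mathbb{R}$ be locally Lipschitz continuous. Then $$\delta_\varepsilon f(x)=\partial f\big(\overline{B_\varepsilon(x)}\big)\quad\text{for all } x\in\mathbb{R}^n,\ \varepsilon\ge 0,$$ where $\delta_\varepsilon f(x)$ is Goldstein's $\varepsilon$-generalized gradient and $\partial f(\overline{B_\varepsilon(x)})$ is the gradient of $f$ on the closed ball $\overline{B_\varepsilon(x)}$.
   Context: $\overline{B_\varepsilon(x)}$ denotes the closed ball of radius $\varepsilon$ about $x$, with $\overline{B_0(x)}=\{x\}$. Goldstein's $\varepsilon$-generalized gradient of $f$ at $x\in\mathbb{R}^n$, $\varepsilon\ge0$, is $$\delta_\varepsilon f(x):=\operatorname{conv}\bigcap_{k=1}^\infty\overline{\{f'(y)\mid y\in\overline{B_{\varepsilon+1/k}(x)},\ f'(y)\text{ exists}\}},$$ where $f'(y)$ is the usual derivative and the outer bar denotes closure. For $f$ Lipschitz near $x$, Clarke's generalized directional derivative is $f^0(x;h)=\limsup_{y\to x,\,t\downarrow 0}\frac{f(y+th)-f(y)}{t}$ and Clarke's generalized gradient is $\partial f(x)=\{a\mid\langle a,h\rangle\le f^0(x;h)\ \forall h\}$ (a subset of the dual space). For nonempty $A\subset\mathbb{R}^n$, the gradient of $f$ on $A$ is $\partial f(A):=\overline{\operatorname{conv}}^*\bigcup_{y\in A}\partial f(y)$, the weak$^*$ closure (here simply the closure) of the convex hull. *)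

theory Defs
  imports "HOL-Analysis.Analysis"
begin

text \<open>
  Derivatives and generalized gradients live in the dual space, rendered as the type
  \<open>'a \<Rightarrow>\<^sub>L real\<close>; the pairing of a functional \<open>a\<close> with a vector \<open>h\<close> is
  \<open>blinfun_apply a h\<close>.
\<close>

definition locally_lipschitz :: "('a::metric_space \<Rightarrow> 'b::metric_space) \<Rightarrow> bool"
  where "locally_lipschitz f \<longleftrightarrow> (\<forall>x. \<exists>u>0. \<exists>L. L-lipschitz_on (cball x u) f)"

definition goldstein_gradient ::
    "real \<Rightarrow> ('a::euclidean_space \<Rightarrow> real) \<Rightarrow> 'a \<Rightarrow> ('a \<Rightarrow>\<^sub>L real) set"
  where "goldstein_gradient \<epsilon> f x =
    convex hull (\<Inter>k\<in>{1::nat..}.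
      closure {D. \<exists>y \<in> cball x (\<epsilon> + 1 / real k). (f has_derivative blinfun_apply D) (at y)})"

text \<open>
  The upper limit is taken in \<open>ereal\<close> so that it exists for every \<open>f\<close>; it is finite when
  \<open>f\<close> is Lipschitz near \<open>x\<close>. The base points \<open>y\<close> tending to \<open>x\<close> may equal \<open>x\<close>.
\<close>

definition clarke_dderiv :: "('a::real_normed_vector \<Rightarrow> real) \<Rightarrow> 'a \<Rightarrow> 'a \<Rightarrow> ereal"
  where "clarke_dderiv f x h =
    Limsup (nhds x \<times>\<^sub>F at_right 0) (\<lambda>(y, t). ereal ((f (y + t *\<^sub>R h) - f y) / t))"

definition clarke_gradient ::
    "('a::real_normed_vector \<Rightarrow> real) \<Rightarrow> 'a \<Rightarrow> ('a \<Rightarrow>\<^sub>L real) set"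
  where "clarke_gradient f x = {a. \<forall>h. ereal (blinfun_apply a h) \<le> clarke_dderiv f x h}"

text \<open>
  The weak* closure is rendered by the norm closure of \<open>'a \<Rightarrow>\<^sub>L real\<close>. The two agree because
  \<open>'a\<close> is finite-dimensional, whence the restriction to \<open>euclidean_space\<close>.
\<close>

definition gradient_on ::
    "('a::euclidean_space \<Rightarrow> real) \<Rightarrow> 'a set \<Rightarrow> ('a \<Rightarrow>\<^sub>L real) set"
  where "gradient_on f A = closure (convex hull (\<Union>y\<in>A. clarke_gradient f y))"

end

theory Submission
  imports Defs
begin

text \<open>
  Both gradients depend only on \<open>f\<close> near the ball, where \<open>f\<close> agrees with a globally Lipschitz
  function. A limit of derivatives at points approaching the ball is a Clarke subgradient at a point
  of the ball, because \<open>f' z h \<le> f\<^sup>0 z h\<close> and \<open>f\<^sup>0\<close> is upper semicontinuous. Conversely, a Clarke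
  subgradient \<open>a\<close> at \<open>y\<close> outside the compact convex set \<open>\<delta>\<^sub>\<epsilon> f x\<close> would be separated from it by some
  \<open>h\<close> and \<open>\<beta>\<close>; then \<open>f' z h \<le> \<beta>\<close> wherever \<open>f' z\<close> exists near \<open>y\<close>, and since \<open>f\<close> is differentiable
  almost everywhere, also on almost every line parallel to \<open>h\<close>, integration along such lines gives
  \<open>f\<^sup>0 y h \<le> \<beta> < a h\<close>.

  Rademacher's theorem is proved without Vitali coverings: in dimension one, a closed set on which a
  Lipschitz function oscillates between two slopes has density at most some \<open>\<theta> < 1\<close> in every
  interval, hence is null. Tonelli's theorem gives directional derivatives almost everywhere, and
  their additivity follows because a closed set has only countably many isolated points on a line.
\<close>


section \<open>Lipschitz functions on the real line\<close>

text \<open>The set of \<open>t\<close> with \<open>V t \<le> V a\<close> is compact. Its largest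
  element must be \<open>b\<close>, since otherwise a right step leads to a larger element.\<close>

lemma nonincreasing_of_right_steps:
  fixes V :: "real \<Rightarrow> real"
  assumes "continuous_on {a..b} V" "a \<le> b"
    and step: "\<And>t. a \<le> t \<Longrightarrow> t < b \<Longrightarrow> \<exists>s\<in>{t<..b}. V s \<le> V t"
  shows "V b \<le> V a"
proof (rule ccontr)
  assume "\<not> V b \<le> V a"
  define S where "S = {t\<in>{a..b}. V t \<le> V a}"
  have "closed S"
    unfolding S_def using assms(1) by (intro continuous_on_closed_Collect_le) auto
  then have "compact S"
    by (rule compact_Int_closed[of "{a..b}" S, simplified, THEN back_subst[of compact]]) (auto simp: S_def)
  moreover have "a \<in> S" using \<open>a \<le> b\<close> by (simp add: S_def)
  ultimately obtain t where t: "t \<in> S" "\<And>s. s \<in> S \<Longrightarrow> s \<le> t"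
    by (metis compact_attains_sup empty_iff)
  then have "a \<le> t" "t < b" "V t \<le> V a"
    using \<open>\<not> V b \<le> V a\<close> by (auto simp: S_def less_le)
  then obtain s where "s \<in> {t<..b}" "V s \<le> V t" using step by blast
  then show False using t(2)[of s] \<open>a \<le> t\<close> \<open>V t \<le> V a\<close> by (auto simp: S_def)
qed

text \<open>A half turn of the graph, passing to \<open>- V (- t)\<close>, keeps the direction of
  monotonicity and turns left steps into right steps.\<close>

lemma nonincreasing_of_left_steps:
  fixes V :: "real \<Rightarrow> real"
  assumes "continuous_on {a..b} V" "a \<le> b"
    and step: "\<And>t. a < t \<Longrightarrow> t \<le> b \<Longrightarrow> \<exists>s\<in>{a..<t}. V t \<le> V s"
  shows "V b \<le> V a"
proof -
  have "- V (- (- a)) \<le> - V (- (- b))"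
  proof (rule nonincreasing_of_right_steps[where V = "\<lambda>t. - V (- t)" and a = "- b" and b = "- a"])
    show "continuous_on {- b..- a} (\<lambda>t. - V (- t))"
      by (intro continuous_intros continuous_on_compose2[OF assms(1)]) auto
    show "\<exists>s\<in>{t<..- a}. - V (- s) \<le> - V (- t)" if "- b \<le> t" "t < - a" for t
    proof -
      have "\<exists>s\<in>{a..<- t}. V (- t) \<le> V s"
        by (rule step) (use that in auto)
      then obtain s where "s \<in> {a..<- t}" "V (- t) \<le> V s" by blast
      then show ?thesis by (intro bexI[of _ "- s"]) auto
    qed
  qed (use \<open>a \<le> b\<close> in auto)
  then show ?thesis by simp
qed

lemma measure_Int_Icc_split:
  fixes K :: "real set"
  assumes "closed K" "a \<le> s" "s \<le> t"
  shows "measure lebesgue (K \<inter> {a..t}) = measure lebesgue (K \<inter> {a..s}) + measure lebesgue (K \<inter> {s<..t})"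
proof -
  have "K \<inter> {a..t} = (K \<inter> {a..s}) \<union> (K \<inter> {s<..t})" using assms by auto
  moreover have "K \<inter> {a..s} \<in> lmeasurable"
    by (rule fmeasurableI2[of "{a..s}"]) (use \<open>closed K\<close> in auto)
  moreover have "K \<inter> {s<..t} \<in> lmeasurable"
    by (rule fmeasurableI2[of "{s..t}"]) (use \<open>closed K\<close> in auto)
  moreover have "(K \<inter> {a..s}) \<inter> (K \<inter> {s<..t}) = {}" by auto
  ultimately show ?thesis by (simp add: measure_Un3)
qed

lemma measure_Int_Ioc_le:
  fixes K :: "real set"
  assumes "closed K" "s \<le> t"
  shows "measure lebesgue (K \<inter> {s<..t}) \<le> t - s"
proof -
  have "measure lebesgue (K \<inter> {s<..t}) \<le> measure lebesgue {s..t}"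
    by (rule measure_mono_fmeasurable) (use \<open>closed K\<close> in auto)
  then show ?thesis using \<open>s \<le> t\<close> by simp
qed

lemma increment_ge_of_steep_steps:
  fixes g :: "real \<Rightarrow> real"
  assumes g: "L-lipschitz_on UNIV g" and K: "closed K" and "a \<le> b" and "- L \<le> q"
    and F: "F = at_right 0 \<or> F = at_left 0"
    and steep: "\<And>t. t \<in> K \<Longrightarrow> \<exists>\<^sub>F r in F. q \<le> (g (t + r) - g t) / r"
  shows "q * measure lebesgue (K \<inter> {a..b}) - L * (b - a - measure lebesgue (K \<inter> {a..b})) \<le> g b - g a"
proof -
  \<comment> \<open>\<open>V\<close> does not increase: at points of \<open>K\<close> by steepness, and off \<open>K\<close>, where \<open>m\<close> is locally
    constant because \<open>K\<close> is closed, by the Lipschitz bound.\<close>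
  define m where "m t = measure lebesgue (K \<inter> {a..t})" for t
  define V where "V t = (q + L) * m t - L * (t - a) - g t" for t
  have m_split: "m t = m s + measure lebesgue (K \<inter> {s<..t})" if "a \<le> s" "s \<le> t" for s t
    unfolding m_def using measure_Int_Icc_split[OF K that] .
  have m_le: "m t - m s \<le> t - s" if "a \<le> s" "s \<le> t" for s t
    using m_split[OF that] measure_Int_Ioc_le[OF K that(2)] by simp
  have m_mono: "m s \<le> m t" if "a \<le> s" "s \<le> t" for s t
    using m_split[OF that] by simp
  have "1-lipschitz_on {a..b} m"
  proof (rule lipschitz_onI)
    fix s t assume "s \<in> {a..b}" "t \<in> {a..b}"
    then show "dist (m s) (m t) \<le> 1 * dist s t"
      using m_le[of s t] m_mono[of s t] m_le[of t s] m_mono[of t s] by (cases "s \<le> t") (auto simp: dist_real_def)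
  qed simp
  then have "continuous_on {a..b} m" by (rule lipschitz_on_continuous_on)
  moreover have "continuous_on {a..b} g"
    using lipschitz_on_continuous_on[OF g] continuous_on_subset by blast
  ultimately have contV: "continuous_on {a..b} V"
    unfolding V_def by (intro continuous_intros)
  have g_lip: "g s - g t \<le> L * (t - s)" if "s \<le> t" for s t
    using lipschitz_onD[OF g, of s t] that by (simp add: dist_real_def abs_le_iff)
  have V_step: "V t \<le> V s" if "a \<le> s" "s < t" and or: "q \<le> (g t - g s) / (t - s) \<or> K \<inter> {s<..<t} = {}" for s t
    using or
  proof
    assume "q \<le> (g t - g s) / (t - s)"
    then have "q * (t - s) \<le> g t - g s" using \<open>s < t\<close> by (simp add: field_simps)
    \<comment> \<open>Here \<open>- L \<le> q\<close> enters: \<open>m\<close> grows at rate at most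
      1, and this bound is multiplied by \<open>q + L\<close>, which must be nonnegative.\<close>
    moreover have "(q + L) * (m t - m s) \<le> (q + L) * (t - s)"
      using m_le[of s t] that \<open>- L \<le> q\<close> by (intro mult_left_mono) auto
    ultimately show ?thesis by (simp add: V_def algebra_simps)
  next
    assume "K \<inter> {s<..<t} = {}"
    then have "K \<inter> {s<..t} \<subseteq> {t}" by auto
    then have "negligible (K \<inter> {s<..t})" by (rule negligible_subset[OF negligible_sing])
    then have "m t = m s" using m_split[of s t] that by (simp add: negligible_imp_measure0)
    then show ?thesis using g_lip[of s t] \<open>s < t\<close> by (simp add: V_def algebra_simps)
  qed
  have off: "\<exists>e>0. K \<inter> {t - e<..<t + e} = {}" if "t \<notin> K" for t
  proof -
    obtain e where "e > 0" "ball t e \<subseteq> - K"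
      using K \<open>t \<notin> K\<close> by (meson ComplI open_Compl open_contains_ball)
    then show ?thesis by (intro exI[of _ e]) (auto simp: ball_eq_greaterThanLessThan)
  qed
  have "V b \<le> V a"
    using F
  proof
    assume F: "F = at_right 0"
    show ?thesis
    proof (rule nonincreasing_of_right_steps[OF contV \<open>a \<le> b\<close>])
      fix t assume t: "a \<le> t" "t < b"
      show "\<exists>s\<in>{t<..b}. V s \<le> V t"
      proof (cases "t \<in> K")
        case True
        have "\<forall>\<^sub>F r in at_right 0. r \<in> {0<..<b - t}"
          unfolding eventually_at_right_field using t by (intro exI[of _ "b - t"]) auto
        from frequently_ex[OF frequently_eventually_conj[OF steep[OF True, unfolded F] this]]
        obtain r where "r \<in> {0<..<b - t}" "q \<le> (g (t + r) - g t) / r" by blast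
        then show ?thesis using V_step[of t "t + r"] t by (intro bexI[of _ "t + r"]) auto
      next
        case False
        then obtain e where "e > 0" "K \<inter> {t - e<..<t + e} = {}" using off by blast
        moreover have "{t<..<min b (t + e)} \<subseteq> {t - e<..<t + e}" using \<open>e > 0\<close> by auto
        ultimately have "K \<inter> {t<..<min b (t + e)} = {}" by blast
        then show ?thesis using V_step[of t "min b (t + e)"] t \<open>e > 0\<close>
          by (intro bexI[of _ "min b (t + e)"]) auto
      qed
    qed
  next
    assume F: "F = at_left 0"
    show ?thesis
    proof (rule nonincreasing_of_left_steps[OF contV \<open>a \<le> b\<close>])
      fix t assume t: "a < t" "t \<le> b"
      show "\<exists>s\<in>{a..<t}. V t \<le> V s"
      proof (cases "t \<in> K")
        case True
        have "\<forall>\<^sub>F r in at_left 0. r \<in> {a - t<..<0}"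
          unfolding eventually_at_left_field using t by (intro exI[of _ "a - t"]) auto
        from frequently_ex[OF frequently_eventually_conj[OF steep[OF True, unfolded F] this]]
        obtain r where r: "r \<in> {a - t<..<0}" "q \<le> (g (t + r) - g t) / r" by blast
        moreover have "(g (t + r) - g t) / r = (g t - g (t + r)) / (t - (t + r))"
          using r(1) by (simp add: field_simps)
        ultimately show ?thesis using V_step[of "t + r" t] by (intro bexI[of _ "t + r"]) auto
      next
        case False
        then obtain e where "e > 0" "K \<inter> {t - e<..<t + e} = {}" using off by blast
        moreover have "{max a (t - e)<..<t} \<subseteq> {t - e<..<t + e}" using \<open>e > 0\<close> by auto
        ultimately have "K \<inter> {max a (t - e)<..<t} = {}" by blast
        then show ?thesis using V_step[of "max a (t - e)" t] t \<open>e > 0\<close>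
          by (intro bexI[of _ "max a (t - e)"]) auto
      qed
    qed
  qed
  moreover have "m a = 0"
    unfolding m_def by (intro negligible_imp_measure0 negligible_subset[OF negligible_sing[of a]]) auto
  ultimately show ?thesis by (simp add: V_def m_def algebra_simps)
qed

text \<open>Cover the part of \<open>K\<close> in a bounded interval, of measure \<open>m\<close>,
  by nonoverlapping intervals of total length at most \<open>m + e\<close>. The density bound on
  each of them gives \<open>m \<le> \<theta> * (m + e)\<close>, and \<open>e\<close> is arbitrary,
  so \<open>m = 0\<close>.\<close>

lemma negligible_of_low_density:
  fixes K :: "real set"
  assumes K: "K \<in> sets lebesgue" and "\<theta> < 1"
    and density: "\<And>a b. a \<le> b \<Longrightarrow> measure lebesgue (K \<inter> {a..b}) \<le> \<theta> * (b - a)"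
  shows "negligible K"
proof -
  have "negligible (K \<inter> {c..d})" if "c \<le> d" for c d
  proof -
    let ?S = "K \<inter> {c..d}"
    have S: "?S \<in> lmeasurable" by (rule fmeasurableI2[of "{c..d}"]) (use K in auto)
    have "\<theta> \<ge> 0" using order_trans[OF measure_nonneg density[of 0 1]] by simp
    have "(1 - \<theta>) * measure lebesgue ?S \<le> e" if "e > 0" for e
    proof -
      obtain D where D: "countable D" "\<And>I. I \<in> D \<Longrightarrow> I \<subseteq> cbox c d \<and> I \<noteq> {} \<and> (\<exists>u v. I = cbox u v)"
          "pairwise (\<lambda>A B. interior A \<inter> interior B = {}) D"
          "?S \<subseteq> \<Union>D" "\<Union>D \<in> lmeasurable" "measure lebesgue (\<Union>D) \<le> measure lebesgue ?S + e"
        by (rule measurable_outer_intervals_bounded[OF S _ \<open>e > 0\<close>, of c d]) auto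
      have "measure lebesgue (\<Union>I\<in>D. K \<inter> I) \<le> \<theta> * (measure lebesgue ?S + e)"
      proof (rule measure_UN_bound[OF \<open>countable D\<close>])
        show "K \<inter> I \<in> lmeasurable" if "I \<in> D" for I
          using D(2)[OF that] by (auto intro!: fmeasurableI2[of I] K)
        fix D' assume D': "D' \<subseteq> D" "finite D'"
        have lm: "I \<in> lmeasurable" if "I \<in> D'" for I using D(2)[of I] D' that by auto
        have "measure lebesgue (\<Union>I\<in>D'. K \<inter> I) \<le> (\<Sum>I\<in>D'. measure lebesgue (K \<inter> I))"
          by (rule measure_UNION_le) (use D' lm K in \<open>auto simp: fmeasurableD\<close>)
        also have "\<dots> \<le> (\<Sum>I\<in>D'. \<theta> * measure lebesgue I)"
        proof (rule sum_mono)
          fix I assume "I \<in> D'"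
          then obtain u v where I: "I = {u..v}" "I \<noteq> {}" using D(2) D' by (metis cbox_interval subsetD)
          then show "measure lebesgue (K \<inter> I) \<le> \<theta> * measure lebesgue I" using density[of u v] by simp
        qed
        also have "\<dots> = \<theta> * measure lebesgue (\<Union>D')"
        proof -
          \<comment> \<open>Two intervals with disjoint interiors meet in a convex set with empty
            interior, which is null, so the lengths add up.\<close>
          have "measure lebesgue (\<Union>D') = (\<Sum>I\<in>D'. measure lebesgue I)"
          proof (rule measure_negligible_finite_Union[OF \<open>finite D'\<close> lm])
            show "pairwise (\<lambda>S T. negligible (S \<inter> T)) D'"
              unfolding pairwise_def
            proof (intro ballI impI)
              fix S T assume "S \<in> D'" "T \<in> D'" "S \<noteq> T"
              then have "interior (S \<inter> T) = {}" "convex (S \<inter> T)"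
                using D(2)[of S] D(2)[of T] D(3) D'(1)
                by (auto simp: pairwise_def subset_iff intro: convex_Int convex_box)
              then show "negligible (S \<inter> T)" by (simp add: negligible_convex_interior)
            qed
          qed
          then show ?thesis by (simp add: sum_distrib_left)
        qed
        also have "\<dots> \<le> \<theta> * measure lebesgue (\<Union>D)"
          using D' lm D(5) \<open>\<theta> \<ge> 0\<close> by (intro mult_left_mono measure_mono_fmeasurable Union_mono) (auto simp: fmeasurableD intro!: sets.finite_Union)
        also have "\<dots> \<le> \<theta> * (measure lebesgue ?S + e)" using D(6) \<open>\<theta> \<ge> 0\<close> by (intro mult_left_mono)
        finally show "measure lebesgue (\<Union>I\<in>D'. K \<inter> I) \<le> \<theta> * (measure lebesgue ?S + e)" .
      qed
      moreover have "(\<Union>I\<in>D. K \<inter> I) = ?S" using D(2,4) by fastforce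
      ultimately have "(1 - \<theta>) * measure lebesgue ?S \<le> \<theta> * e" by (simp add: algebra_simps)
      also have "\<dots> \<le> 1 * e" using \<open>\<theta> < 1\<close> \<open>e > 0\<close> by (intro mult_right_mono) auto
      finally show ?thesis by simp
    qed
    then have "(1 - \<theta>) * measure lebesgue ?S \<le> 0"
      by (intro field_le_epsilon[of _ 0]) simp
    then have "measure lebesgue ?S = 0" using \<open>\<theta> < 1\<close>
      by (smt (verit, best) measure_nonneg mult_pos_pos)
    then show ?thesis using S by (simp add: negligible_iff_measure)
  qed
  then have "negligible (K \<inter> {c..d})" for c d
    by (cases "c \<le> d") auto
  then show ?thesis
    by (subst negligible_on_intervals) auto
qed

text \<open>On a closed \<open>K\<close> inside \<open>E\<close>, the increment bound is applied to
  \<open>g\<close> with slope \<open>q\<close> and to \<open>- g\<close> with slope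
  \<open>- p\<close>. Adding the two cancels \<open>g b - g a\<close> and leaves a density bound
  below 1; inner regularity passes from \<open>K\<close> to \<open>E\<close>. The filters
  \<open>F\<close> and \<open>G\<close> may differ, so disagreeing one-sided derivatives are covered
  as well.\<close>

lemma negligible_steep_shallow:
  fixes g :: "real \<Rightarrow> real"
  assumes g: "L-lipschitz_on UNIV g" and E: "E \<in> sets lebesgue" and "p < q"
    and F: "F = at_right 0 \<or> F = at_left 0" and G: "G = at_right 0 \<or> G = at_left 0"
    and steep: "\<And>t. t \<in> E \<Longrightarrow> \<exists>\<^sub>F r in F. q \<le> (g (t + r) - g t) / r"
    and shallow: "\<And>t. t \<in> E \<Longrightarrow> \<exists>\<^sub>F r in G. (g (t + r) - g t) / r \<le> p"
  shows "negligible E"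
proof -
  have neg: "(- g (t + r) - - g t) / r = - ((g (t + r) - g t) / r)" for t r
    by (simp add: diff_divide_distrib)
  have negl: "negligible K" if K: "closed K" "K \<subseteq> E" for K
  proof -
    \<comment> \<open>A Lipschitz constant for \<open>g\<close> and \<open>- g\<close> that is large
      enough to satisfy the lower bound on the slope in both applications.\<close>
    define M where "M = L + \<bar>p\<bar> + \<bar>q\<bar>"
    have "L \<ge> 0" using g by (rule lipschitz_on_nonneg)
    then have "M > 0" "- M \<le> q" "- M \<le> - p" using \<open>p < q\<close> by (auto simp: M_def)
    have gM: "M-lipschitz_on UNIV g" "M-lipschitz_on UNIV (\<lambda>t. - g t)"
      using lipschitz_on_mono[OF g] by (auto simp: M_def lipschitz_on_minus)
    define \<theta> where "\<theta> = 2 * M / (q - p + 2 * M)"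
    have "\<theta> < 1" using \<open>M > 0\<close> \<open>p < q\<close> by (simp add: \<theta>_def field_simps)
    have "measure lebesgue (K \<inter> {a..b}) \<le> \<theta> * (b - a)" if "a \<le> b" for a b
    proof -
      let ?m = "measure lebesgue (K \<inter> {a..b})"
      have "q * ?m - M * (b - a - ?m) \<le> g b - g a"
        by (rule increment_ge_of_steep_steps[OF gM(1) K(1) that \<open>- M \<le> q\<close> F]) (use steep K in blast)
      moreover have "- p * ?m - M * (b - a - ?m) \<le> - g b - (- g a)"
      proof (rule increment_ge_of_steep_steps[OF gM(2) K(1) that \<open>- M \<le> - p\<close> G])
        fix t assume "t \<in> K"
        then show "\<exists>\<^sub>F r in G. - p \<le> (- g (t + r) - - g t) / r"
          unfolding neg using shallow[of t] K by auto
      qed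
      ultimately have "(q - p + 2 * M) * ?m \<le> 2 * M * (b - a)" by (simp add: algebra_simps)
      then show ?thesis using \<open>M > 0\<close> \<open>p < q\<close> by (simp add: \<theta>_def field_simps)
    qed
    then show ?thesis
      using negligible_of_low_density[of K \<theta>] K \<open>\<theta> < 1\<close> by simp
  qed
  show ?thesis
    unfolding negligible_outer_le
  proof (intro allI impI)
    fix e :: real assume "e > 0"
    obtain K where K: "closed K" "K \<subseteq> E" "E - K \<in> lmeasurable" "emeasure lebesgue (E - K) < ennreal e"
      using sets_lebesgue_inner_closed[OF E \<open>e > 0\<close>] .
    have "K \<in> lmeasurable" "measure lebesgue K = 0"
      using negl[OF K(1,2)] by (auto simp: negligible_iff_measure)
    moreover have "K \<union> (E - K) = E" using K(2) by blast
    ultimately have "E \<in> lmeasurable" "measure lebesgue E \<le> measure lebesgue (E - K)"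
      using fmeasurable.Un[OF _ K(3), of K] measure_Un_le[of K lebesgue "E - K"] K(3) by (auto simp: fmeasurableD)
    moreover have "measure lebesgue (E - K) < e"
      using K(3,4) \<open>e > 0\<close> by (simp add: emeasure_eq_measure2 ennreal_less_iff)
    ultimately show "\<exists>T. E \<subseteq> T \<and> T \<in> lmeasurable \<and> measure lebesgue T \<le> e" by force
  qed
qed

text \<open>The increment bound for \<open>- g\<close> is applied to a closed set of good points
  that misses only measure \<open>\<eta>\<close> of the interval. The Lipschitz bound controls the
  rest at a cost of \<open>(M - c) * \<eta>\<close>.\<close>

lemma mean_value_le_except_negligible:
  fixes g :: "real \<Rightarrow> real"
  assumes g: "L-lipschitz_on UNIV g" and T: "negligible T" and "a \<le> b"
    and slope: "\<And>t. t \<in> {a..b} - T \<Longrightarrow> \<exists>\<^sub>F r in at_right 0. (g (t + r) - g t) / r \<le> c"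
  shows "g b - g a \<le> c * (b - a)"
proof -
  have neg: "(- g (t + r) - - g t) / r = - ((g (t + r) - g t) / r)" for t r
    by (simp add: diff_divide_distrib)
  define M where "M = L + \<bar>c\<bar>"
  have "L \<ge> 0" using g by (rule lipschitz_on_nonneg)
  then have "- M \<le> - c" "M \<ge> c" by (auto simp: M_def)
  have gM: "M-lipschitz_on UNIV (\<lambda>t. - g t)"
    using lipschitz_on_mono[OF g] by (auto simp: M_def lipschitz_on_minus)
  have I: "{a..b} - T \<in> sets lebesgue" using T by (auto simp: negligible_imp_sets)
  have mI: "measure lebesgue ({a..b} - T) = b - a"
    using measure_Diff_null_set[of "{a..b}" lebesgue T] T \<open>a \<le> b\<close> by (simp add: negligible_iff_null_sets)
  have "g b - g a \<le> c * (b - a) + (M - c) * \<eta>" if "\<eta> > 0" for \<eta>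
  proof -
    obtain K where K: "closed K" "K \<subseteq> {a..b} - T" "{a..b} - T - K \<in> lmeasurable"
        "emeasure lebesgue ({a..b} - T - K) < ennreal \<eta>"
      using sets_lebesgue_inner_closed[OF I \<open>\<eta> > 0\<close>] .
    let ?m = "measure lebesgue (K \<inter> {a..b})"
    have "K \<inter> {a..b} = K" using K(2) by auto
    have "K \<in> lmeasurable" by (rule fmeasurableI2[of "{a..b}"]) (use K in auto)
    have "measure lebesgue ({a..b} - T - K) < \<eta>"
      using K(3,4) \<open>\<eta> > 0\<close> by (simp add: emeasure_eq_measure2 ennreal_less_iff)
    moreover have "measure lebesgue ({a..b} - T - K) = (b - a) - ?m"
    proof -
      have "{a..b} - T \<in> lmeasurable" by (rule fmeasurableI2[of "{a..b}"]) (use I in auto)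
      then show ?thesis
        using measurable_measure_Diff[of "{a..b} - T" lebesgue K] K(2) fmeasurableD[OF \<open>K \<in> lmeasurable\<close>]
        unfolding mI \<open>K \<inter> {a..b} = K\<close> by blast
    qed
    ultimately have m: "b - a - ?m \<le> \<eta>" by simp
    have "- c * ?m - M * (b - a - ?m) \<le> - g b - - g a"
    proof (rule increment_ge_of_steep_steps[OF gM K(1) \<open>a \<le> b\<close> \<open>- M \<le> - c\<close>, of "at_right 0"])
      fix t assume "t \<in> K"
      then show "\<exists>\<^sub>F r in at_right 0. - c \<le> (- g (t + r) - - g t) / r"
        unfolding neg using slope[of t] K by auto
    qed simp
    then have "g b - g a \<le> c * (b - a) + (M - c) * (b - a - ?m)" by (simp add: algebra_simps)
    also have "\<dots> \<le> c * (b - a) + (M - c) * \<eta>"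
      using m \<open>M \<ge> c\<close> by (intro add_left_mono mult_left_mono) auto
    finally show ?thesis .
  qed
  note * = this
  show ?thesis
  proof (rule field_le_epsilon)
    fix e :: real assume "e > 0"
    \<comment> \<open>The summand 1 keeps the denominator positive when
      \<open>M = c\<close>.\<close>
    have "(M - c) * (e / (M - c + 1)) \<le> e" using \<open>M \<ge> c\<close> \<open>e > 0\<close> by (simp add: field_simps)
    moreover have "e / (M - c + 1) > 0" using \<open>M \<ge> c\<close> \<open>e > 0\<close> by simp
    ultimately show "g b - g a \<le> c * (b - a) + e"
      using *[of "e / (M - c + 1)"] by linarith
  qed
qed

section \<open>Null sets and lines\<close>

lemma borel_line_section:
  fixes N :: "'a::euclidean_space set"
  assumes N: "N \<in> sets borel"
  shows "{t. x + t *\<^sub>R v \<in> N} \<in> sets borel"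
proof -
  have "(\<lambda>t. x + t *\<^sub>R v) \<in> borel_measurable borel" by measurable
  from measurable_sets[OF this N] show ?thesis by (simp add: vimage_def)
qed

text \<open>Tonelli: for fixed \<open>t\<close> the base points \<open>x\<close> form a translate of
  \<open>N\<close>, and integrating the constant over all \<open>t\<close> gives the infinite
  factor. Since infinity times 0 is 0, the identity serves in both directions: null sections force
  \<open>N\<close> to be null, and a null \<open>N\<close> has almost only null sections. Base
  points range over the whole space, so no coordinates transversal to \<open>v\<close> are needed
  and \<open>v = 0\<close> is allowed.\<close>

lemma nn_integral_emeasure_lines:
  fixes N :: "'a::euclidean_space set"
  assumes N: "N \<in> sets borel"
  shows "(\<integral>\<^sup>+x. emeasure lborel {t::real. x + t *\<^sub>R v \<in> N} \<partial>lborel) = \<infinity> * emeasure lborel N"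
proof -
  have meas: "(\<lambda>(x, t). indicator N (x + t *\<^sub>R v) :: ennreal) \<in> borel_measurable (lborel \<Otimes>\<^sub>M lborel)"
    using N by measurable
  have "(\<integral>\<^sup>+x. emeasure lborel {t::real. x + t *\<^sub>R v \<in> N} \<partial>lborel)
      = (\<integral>\<^sup>+x. \<integral>\<^sup>+t. indicator N (x + t *\<^sub>R v) \<partial>lborel \<partial>lborel)"
  proof (intro nn_integral_cong)
    fix x
    have "emeasure lborel {t::real. x + t *\<^sub>R v \<in> N} = (\<integral>\<^sup>+t. indicator {t. x + t *\<^sub>R v \<in> N} t \<partial>lborel)"
      by (rule nn_integral_indicator[symmetric]) (simp add: borel_line_section[OF N])
    then show "emeasure lborel {t::real. x + t *\<^sub>R v \<in> N} = (\<integral>\<^sup>+t. indicator N (x + t *\<^sub>R v) \<partial>lborel)"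
      by (simp add: indicator_def)
  qed
  also have "\<dots> = (\<integral>\<^sup>+t. \<integral>\<^sup>+x. indicator N (x + t *\<^sub>R v) \<partial>lborel \<partial>lborel)"
    using lborel_pair.Fubini'[OF meas] by simp
  also have "\<dots> = (\<integral>\<^sup>+(t::real). emeasure lborel N \<partial>lborel)"
  proof (intro nn_integral_cong)
    fix t :: real
    have "(\<integral>\<^sup>+x. indicator N (x + t *\<^sub>R v) \<partial>lborel) = (\<integral>\<^sup>+x. indicator N x \<partial>(distr lborel borel ((+) (t *\<^sub>R v))))"
      using N by (subst nn_integral_distr) (auto simp: add.commute)
    then show "(\<integral>\<^sup>+x. indicator N (x + t *\<^sub>R v) \<partial>lborel) = emeasure lborel N"
      using N by (simp add: lborel_distr_plus)
  qed
  also have "\<dots> = \<infinity> * emeasure lborel N" by (simp add: mult.commute)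
  finally show ?thesis .
qed

lemma negligible_borel_iff:
  "N \<in> sets borel \<Longrightarrow> negligible N \<longleftrightarrow> emeasure lborel N = 0"
  by (simp add: negligible_iff_emeasure0)

lemma negligible_if_negligible_on_lines:
  fixes N :: "'a::euclidean_space set"
  assumes N: "N \<in> sets borel" and "\<And>x. negligible {t::real. x + t *\<^sub>R v \<in> N}"
  shows "negligible N"
proof -
  have "emeasure lborel {t::real. x + t *\<^sub>R v \<in> N} = 0" for x
    using assms(2)[of x] negligible_borel_iff[OF borel_line_section[OF N]] by blast
  then show ?thesis
    using nn_integral_emeasure_lines[OF N, of v] by (simp add: negligible_borel_iff[OF N] ennreal_top_mult split: if_splits)
qed

lemma AE_negligible_on_lines:
  fixes N :: "'a::euclidean_space set"
  assumes "negligible N"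
  shows "AE x in lborel. negligible {t::real. x + t *\<^sub>R v \<in> N}"
proof -
  \<comment> \<open>A Borel null superset makes the measure of the sections a measurable function of
    the base point.\<close>
  obtain N' where N': "N \<subseteq> N'" "N' \<in> null_sets lborel"
    using assms by (auto simp: negligible_iff_null_sets null_sets_completion_iff2)
  then have B: "N' \<in> sets borel" by auto
  have meas: "(\<lambda>x. emeasure lborel {t::real. x + t *\<^sub>R v \<in> N'}) \<in> borel_measurable lborel"
  proof -
    have "(\<lambda>(x, t). x + t *\<^sub>R v) \<in> lborel \<Otimes>\<^sub>M lborel \<rightarrow>\<^sub>M borel" by measurable
    from measurable_sets[OF this B]
    have "{(x, t). x + t *\<^sub>R v \<in> N'} \<in> sets (lborel \<Otimes>\<^sub>M lborel)"
      by (simp add: vimage_def space_pair_measure case_prod_beta')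
    from lborel.measurable_emeasure_Pair[OF this] show ?thesis by simp
  qed
  have "(\<integral>\<^sup>+x. emeasure lborel {t::real. x + t *\<^sub>R v \<in> N'} \<partial>lborel) = 0"
    using nn_integral_emeasure_lines[OF B, of v] N'(2) by (simp add: null_sets_def)
  then have "AE x in lborel. emeasure lborel {t::real. x + t *\<^sub>R v \<in> N'} = 0"
    using nn_integral_0_iff_AE[OF meas] by simp
  then show ?thesis
  proof (rule AE_mp[OF _ AE_I2], intro impI)
    fix x assume "emeasure lborel {t::real. x + t *\<^sub>R v \<in> N'} = 0"
    then have "negligible {t::real. x + t *\<^sub>R v \<in> N'}"
      using negligible_borel_iff[OF borel_line_section[OF B]] by blast
    then show "negligible {t::real. x + t *\<^sub>R v \<in> N}"
      by (rule negligible_subset) (use N' in auto)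
  qed
qed

section \<open>Directional derivatives\<close>

text \<open>At \<open>r = 0\<close> division by zero yields 0, so the Lipschitz bound on the
  quotient holds for every \<open>r\<close>.\<close>

definition diff_quot :: "('a::real_vector \<Rightarrow> real) \<Rightarrow> 'a \<Rightarrow> 'a \<Rightarrow> real \<Rightarrow> real"
  where "diff_quot f v x r = (f (x + r *\<^sub>R v) - f x) / r"

lemma diff_quot_uminus: "diff_quot (\<lambda>x. - f x) v x r = - diff_quot f v x r"
  by (simp add: diff_quot_def diff_divide_distrib)

lemma abs_diff_quot_le:
  fixes f :: "'a::real_normed_vector \<Rightarrow> real"
  assumes "L-lipschitz_on UNIV f"
  shows "\<bar>diff_quot f v x r\<bar> \<le> L * norm v"
proof (cases "r = 0")
  case True
  then show ?thesis using lipschitz_on_nonneg[OF assms] by (simp add: diff_quot_def)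
next
  case False
  have "\<bar>f (x + r *\<^sub>R v) - f x\<bar> \<le> L * (\<bar>r\<bar> * norm v)"
    using lipschitz_onD[OF assms, of "x + r *\<^sub>R v" x] by (simp add: dist_norm)
  then show ?thesis using False by (simp add: diff_quot_def abs_divide field_simps)
qed

text \<open>Restricting to the scales \<open>1 / (n + 1)\<close> gives a countable conjunction, as
  measurability requires.\<close>

lemma frequently_at_right_0_iff:
  "(\<exists>\<^sub>F r in at_right (0::real). P r) \<longleftrightarrow> (\<forall>n. \<exists>r\<in>{0<..<inverse (real (Suc n))}. P r)"
  unfolding frequently_def eventually_at_right_field
proof safe
  fix n assume "\<not> (\<exists>b>0. \<forall>y>0. y < b \<longrightarrow> \<not> P y)"
  then show "\<exists>r\<in>{0<..<inverse (real (Suc n))}. P r"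
    by (metis greaterThanLessThan_iff inverse_Suc)
next
  fix b :: real assume "\<forall>n. \<exists>r\<in>{0<..<inverse (real (Suc n))}. P r" "b > 0" "\<forall>y>0. y < b \<longrightarrow> \<not> P y"
  then show False by (metis greaterThanLessThan_iff order_less_trans reals_Archimedean)
qed

lemma frequently_at_left_0_iff:
  "(\<exists>\<^sub>F r in at_left (0::real). P r) \<longleftrightarrow> (\<forall>n. \<exists>r\<in>{- inverse (real (Suc n))<..<0}. P r)"
proof -
  have "(\<exists>\<^sub>F r in at_left (0::real). P r) \<longleftrightarrow> (\<exists>\<^sub>F r in at_right (0::real). P (- r))"
    using eventually_at_left_to_right by (simp add: frequently_def at_left_minus eventually_filtermap)
  also have "\<dots> \<longleftrightarrow> (\<forall>n. \<exists>r\<in>{0<..<inverse (real (Suc n))}. P (- r))"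
    by (rule frequently_at_right_0_iff)
  also have "\<dots> \<longleftrightarrow> (\<forall>n. \<exists>r\<in>{- inverse (real (Suc n))<..<0}. P r)"
    by (intro all_cong1 iffI; (elim bexE, rename_tac r, rule_tac x = "- r" in bexI)) auto
  finally show ?thesis .
qed

text \<open>At each scale the union over the uncountably many \<open>r\<close> is a union of open
  sets, hence open. The whole set is therefore a countable intersection of open sets.\<close>

lemma borel_frequently_steep:
  fixes f :: "'a::real_normed_vector \<Rightarrow> real"
  assumes f: "continuous_on UNIV f" and F: "F = at_right 0 \<or> F = at_left 0"
  shows "{x. \<exists>\<^sub>F r in F. q < diff_quot f v x r} \<in> sets borel"
proof -
  have "open {x. q < diff_quot f v x r}" for r
    unfolding diff_quot_def divide_inverse
    by (intro open_Collect_less continuous_intros continuous_on_compose2[OF f]) auto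
  then have "open (\<Union>r\<in>R. {x. q < diff_quot f v x r})" for R by blast
  then have *: "{x. \<forall>n. \<exists>r\<in>R n. q < diff_quot f v x r} \<in> sets borel" for R :: "nat \<Rightarrow> real set"
    by (auto simp: Collect_all_eq Collect_bex_eq)
  show ?thesis
    using F *[of "\<lambda>n. {0<..<inverse (real (Suc n))}"] *[of "\<lambda>n. {- inverse (real (Suc n))<..<0}"]
    by (auto simp: frequently_at_right_0_iff frequently_at_left_0_iff simp del: of_nat_Suc)
qed

text \<open>The limit is the upper limit, written as the supremum of the levels exceeded frequently.
  If values fell frequently below some \<open>a\<close> under it, they would oscillate across two
  rationals lying in between. Rational levels keep the number of exceptional sets countable.\<close>

lemma tendsto_if_no_rational_oscillation:
  fixes \<phi> :: "'b \<Rightarrow> real"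
  assumes bound: "\<And>r. \<bar>\<phi> r\<bar> \<le> B" and "F \<noteq> bot"
    and no_osc: "\<And>p q. p \<in> \<rat> \<Longrightarrow> q \<in> \<rat> \<Longrightarrow> p < q \<Longrightarrow> \<exists>\<^sub>F r in F. q < \<phi> r \<Longrightarrow> \<not> (\<exists>\<^sub>F r in F. \<phi> r < p)"
  shows "\<exists>d. (\<phi> \<longlongrightarrow> d) F"
proof -
  define A where "A = {q. \<exists>\<^sub>F r in F. q < \<phi> r}"
  have "q \<le> B" if "q \<in> A" for q
    using that bound by (auto simp: A_def abs_le_iff dest!: frequently_ex intro: less_imp_le order_trans)
  then have bdd: "bdd_above A" by (rule bdd_aboveI)
  \<comment> \<open>A level strictly below all values is exceeded frequently because
    \<open>F\<close> is not trivial; this makes \<open>A\<close> nonempty.\<close>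
  have "- B - 1 < \<phi> r" for r using bound[of r] by (auto simp: abs_le_iff)
  then have "- B - 1 \<in> A" using \<open>F \<noteq> bot\<close> by (simp add: A_def)
  then have "A \<noteq> {}" by blast
  have "(\<phi> \<longlongrightarrow> Sup A) F"
  proof (rule order_tendstoI)
    fix a assume "a < Sup A"
    then obtain q where q: "q \<in> A" "a < q" using less_cSupE[OF _ \<open>A \<noteq> {}\<close>] by blast
    obtain q' where "q' \<in> \<rat>" "a < q'" "q' < q" using Rats_dense_in_real[OF q(2)] by blast
    obtain p where "p \<in> \<rat>" "a < p" "p < q'" using Rats_dense_in_real[OF \<open>a < q'\<close>] by blast
    have "\<exists>\<^sub>F r in F. q' < \<phi> r"
      using q(1) \<open>q' < q\<close> by (auto simp: A_def elim!: frequently_elim1)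
    then have "\<forall>\<^sub>F r in F. \<not> \<phi> r < p"
      using no_osc[OF \<open>p \<in> \<rat>\<close> \<open>q' \<in> \<rat>\<close> \<open>p < q'\<close>] by (simp add: frequently_def)
    then show "\<forall>\<^sub>F r in F. a < \<phi> r" by eventually_elim (use \<open>a < p\<close> in simp)
  next
    fix a assume "Sup A < a"
    then obtain q where q: "Sup A < q" "q < a" using dense by blast
    then have "q \<notin> A" using cSup_upper[OF _ bdd] by fastforce
    then have "\<forall>\<^sub>F r in F. \<not> q < \<phi> r" by (simp add: A_def frequently_def)
    then show "\<forall>\<^sub>F r in F. \<phi> r < a" by eventually_elim (use q in simp)
  qed
  then show ?thesis ..
qed

lemma negligible_countable_UN:
  assumes "countable I" "\<And>i. i \<in> I \<Longrightarrow> negligible (N i)"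
  shows "negligible (\<Union>i\<in>I. N i)"
  using assms by (simp add: negligible_iff_null_sets null_sets_UN')

text \<open>Where the derivative along \<open>v\<close> fails to exist, the quotients oscillate
  across some rational pair, possibly with one level reached from each side. Each such set is Borel
  and meets every line parallel to \<open>v\<close> in a null set by the one-dimensional
  result.\<close>

lemma negligible_no_directional_derivative:
  fixes f :: "'a::euclidean_space \<Rightarrow> real"
  assumes f: "L-lipschitz_on UNIV f"
  shows "negligible {x. \<nexists>d. (diff_quot f v x \<longlongrightarrow> d) (at 0)}"
proof -
  define sides where "sides = {at_right (0::real), at_left 0}"
  define N where "N p q F G = {x. (\<exists>\<^sub>F r in F. q < diff_quot f v x r) \<and> (\<exists>\<^sub>F r in G. diff_quot f v x r < p)}" for p q F G
  have "negligible (N p q F G)" if "p < q" and FG: "F \<in> sides" "G \<in> sides" for p q F G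
  proof (rule negligible_if_negligible_on_lines)
    have cf: "continuous_on UNIV f" using f by (rule lipschitz_on_continuous_on)
    have F: "F = at_right 0 \<or> F = at_left 0" and G: "G = at_right 0 \<or> G = at_left 0"
      using FG by (auto simp: sides_def)
    \<comment> \<open>Shallowness of \<open>f\<close> is rewritten as steepness of
      \<open>- f\<close>, so one measurability lemma covers both conditions.\<close>
    have "N p q F G = {x. \<exists>\<^sub>F r in F. q < diff_quot f v x r} \<inter> {x. \<exists>\<^sub>F r in G. - p < diff_quot (\<lambda>x. - f x) v x r}"
      by (auto simp: N_def diff_quot_uminus)
    then show B: "N p q F G \<in> sets borel"
      using borel_frequently_steep[OF cf F] borel_frequently_steep[OF continuous_on_minus[OF cf] G] by auto
    fix x
    let ?g = "\<lambda>t. f (x + t *\<^sub>R v)"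
    have quot: "(?g (t + r) - ?g t) / r = diff_quot f v (x + t *\<^sub>R v) r" for t r
      by (simp add: diff_quot_def algebra_simps)
    have "(norm v)-lipschitz_on UNIV (\<lambda>t. x + t *\<^sub>R v)"
      by (rule lipschitz_onI) (auto simp: dist_norm mult.commute simp flip: scaleR_diff_left)
    then have "(L * norm v)-lipschitz_on UNIV ?g"
      using lipschitz_on_compose2[of "norm v" UNIV _ L f] lipschitz_on_subset[OF f] by (simp add: mult.commute)
    then show "negligible {t. x + t *\<^sub>R v \<in> N p q F G}"
    proof (rule negligible_steep_shallow[OF _ _ \<open>p < q\<close> F G])
      show "{t. x + t *\<^sub>R v \<in> N p q F G} \<in> sets lebesgue"
        using borel_line_section[OF B] by auto
    qed (auto simp: quot N_def elim: frequently_elim1)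
  qed
  then have "negligible (\<Union>p\<in>\<rat>. \<Union>q\<in>\<rat> \<inter> {p<..}. \<Union>F\<in>sides. \<Union>G\<in>sides. N p q F G)"
    by (intro negligible_countable_UN countable_rat countable_Int1) (auto simp: sides_def)
  then show ?thesis
  proof (rule negligible_subset[OF _ subsetI], rule_tac ccontr)
    fix x assume x: "x \<in> {x. \<nexists>d. (diff_quot f v x \<longlongrightarrow> d) (at 0)}"
      and notin: "x \<notin> (\<Union>p\<in>\<rat>. \<Union>q\<in>\<rat> \<inter> {p<..}. \<Union>F\<in>sides. \<Union>G\<in>sides. N p q F G)"
    have freq: "(\<exists>\<^sub>F r in at 0. P r) \<longleftrightarrow> (\<exists>F\<in>sides. \<exists>\<^sub>F r in F. P r)" for P
      by (auto simp: frequently_def eventually_at_split sides_def)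
    have "\<exists>d. (diff_quot f v x \<longlongrightarrow> d) (at 0)"
      by (rule tendsto_if_no_rational_oscillation[OF abs_diff_quot_le[OF f]])
        (use notin in \<open>auto simp: freq N_def\<close>)
    with x show False by simp
  qed
qed

section \<open>Additivity of directional derivatives almost everywhere\<close>

text \<open>An isolated point is the only point of \<open>T\<close> in some member of a countable
  basis and can be recovered from that member.\<close>

lemma countable_isolated_points:
  fixes T :: "'a::second_countable_topology set"
  shows "countable {t\<in>T. \<not> t islimpt T}"
proof -
  obtain B :: "'a set set" where B: "countable B" "topological_basis B"
    using ex_countable_basis by blast
  have "{t\<in>T. \<not> t islimpt T} \<subseteq> (\<lambda>U. the_elem (U \<inter> T)) ` B"
  proof
    fix t assume t: "t \<in> {t\<in>T. \<not> t islimpt T}"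
    then obtain U where U: "open U" "t \<in> U" "\<forall>y\<in>T. y \<in> U \<longrightarrow> y = t"
      by (auto simp: islimpt_def)
    then obtain U' where "U' \<in> B" "t \<in> U'" "U' \<subseteq> U"
      using topological_basisE[OF B(2)] by metis
    then have "U' \<inter> T = {t}" using U t by auto
    then show "t \<in> (\<lambda>U. the_elem (U \<inter> T)) ` B" using \<open>U' \<in> B\<close> by (metis image_eqI the_elem_eq)
  qed
  then show ?thesis by (rule countable_subset[OF _ countable_image[OF B(1)]])
qed

text \<open>The weak inequality allows the admissible \<open>r\<close> to be exhausted by compact
  sets.\<close>

lemma frequently_at_0_iff:
  "(\<exists>\<^sub>F r in at (0::real). P r) \<longleftrightarrow> (\<forall>n. \<exists>r. r \<noteq> 0 \<and> \<bar>r\<bar> \<le> inverse (real (Suc n)) \<and> P r)"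
  unfolding frequently_def eventually_at
proof safe
  fix n assume "\<not> (\<exists>d>0. \<forall>x\<in>UNIV. x \<noteq> 0 \<and> dist x 0 < d \<longrightarrow> \<not> P x)"
  then have "\<exists>x. x \<noteq> 0 \<and> dist x 0 < inverse (real (Suc n)) \<and> P x"
    by (metis inverse_positive_iff_positive of_nat_0_less_iff zero_less_Suc)
  then show "\<exists>r. r \<noteq> 0 \<and> \<bar>r\<bar> \<le> inverse (real (Suc n)) \<and> P r"
    by (auto simp: dist_real_def intro: less_imp_le simp del: of_nat_Suc)
next
  fix d :: real
  assume *: "\<forall>n. \<exists>r. r \<noteq> 0 \<and> \<bar>r\<bar> \<le> inverse (real (Suc n)) \<and> P r" "d > 0"
    "\<forall>x\<in>UNIV. x \<noteq> 0 \<and> dist x 0 < d \<longrightarrow> \<not> P x"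
  obtain n where "inverse (real (Suc n)) < d" using reals_Archimedean[OF \<open>d > 0\<close>] by blast
  then show False using *(1)[rule_format, of n] *(3) by (auto simp: dist_real_def)
qed

text \<open>On a line parallel to \<open>u\<close> the exceptional parameters are isolated points of
  the trace of \<open>B\<close>, hence countably many. The remaining work is to show that the
  exceptional set is Borel.\<close>

lemma negligible_isolated_on_lines:
  fixes B :: "'a::euclidean_space set"
  assumes "closed B"
  shows "negligible {x\<in>B. \<forall>\<^sub>F r in at 0. x + r *\<^sub>R u \<notin> B}"
proof (rule negligible_if_negligible_on_lines)
  \<comment> \<open>Bounding \<open>r\<close> away from 0 makes \<open>R n m\<close> compact. Then
    \<open>S n m\<close> is the sum of a closed and a compact set, hence closed, and the union over
    \<open>m\<close> recovers all nonzero \<open>r\<close> at scale \<open>n\<close>.\<close>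
  define R where "R n m = {r::real. inverse (real (Suc m)) \<le> \<bar>r\<bar> \<and> \<bar>r\<bar> \<le> inverse (real (Suc n))}" for n m
  define S where "S n m = {x. \<exists>r\<in>R n m. x + r *\<^sub>R u \<in> B}" for n m
  have cR: "compact (R n m)" for n m
  proof -
    have "R n m = {r. inverse (real (Suc m)) \<le> \<bar>r\<bar>} \<inter> cball 0 (inverse (real (Suc n)))"
      by (auto simp: R_def)
    moreover have "closed {r::real. inverse (real (Suc m)) \<le> \<bar>r\<bar>}"
      by (intro closed_Collect_le continuous_intros)
    ultimately show ?thesis by (simp add: closed_Int_compact)
  qed
  have "closed (S n m)" for n m
  proof -
    have "compact ((\<lambda>r. - (r *\<^sub>R u)) ` R n m)"
      by (intro compact_continuous_image continuous_intros cR)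
    from closed_compact_sums[OF \<open>closed B\<close> this]
    have "closed (\<Union>x\<in>B. \<Union>y\<in>(\<lambda>r. - (r *\<^sub>R u)) ` R n m. {x + y})" .
    moreover have "(\<Union>x\<in>B. \<Union>y\<in>(\<lambda>r. - (r *\<^sub>R u)) ` R n m. {x + y}) = S n m"
    proof (intro equalityI subsetI)
      fix x assume "x \<in> (\<Union>x\<in>B. \<Union>y\<in>(\<lambda>r. - (r *\<^sub>R u)) ` R n m. {x + y})"
      then show "x \<in> S n m" unfolding S_def by (auto intro!: bexI)
    next
      fix x assume "x \<in> S n m"
      then obtain r where "r \<in> R n m" "x + r *\<^sub>R u \<in> B" unfolding S_def by blast
      moreover have "x = (x + r *\<^sub>R u) + - (r *\<^sub>R u)" by simp
      ultimately show "x \<in> (\<Union>x\<in>B. \<Union>y\<in>(\<lambda>r. - (r *\<^sub>R u)) ` R n m. {x + y})" by blast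
    qed
    ultimately show ?thesis by simp
  qed
  then have S: "S n m \<in> sets borel" for n m by simp
  have R_Un: "r \<noteq> 0 \<and> \<bar>r\<bar> \<le> inverse (real (Suc n)) \<longleftrightarrow> (\<exists>m. r \<in> R n m)" for r n
  proof
    assume r: "r \<noteq> 0 \<and> \<bar>r\<bar> \<le> inverse (real (Suc n))"
    then obtain m where "inverse (real (Suc m)) < \<bar>r\<bar>" using reals_Archimedean[of "\<bar>r\<bar>"] by auto
    then show "\<exists>m. r \<in> R n m" using r unfolding R_def by (metis (mono_tags, lifting) less_imp_le mem_Collect_eq)
  next
    assume "\<exists>m. r \<in> R n m"
    then obtain m where "inverse (real (Suc m)) \<le> \<bar>r\<bar>" "\<bar>r\<bar> \<le> inverse (real (Suc n))"
      unfolding R_def by blast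
    moreover have "0 < inverse (real (Suc m))" by simp
    ultimately show "r \<noteq> 0 \<and> \<bar>r\<bar> \<le> inverse (real (Suc n))" by linarith
  qed
  have freq: "(\<exists>\<^sub>F r in at 0. x + r *\<^sub>R u \<in> B) \<longleftrightarrow> (\<forall>n. \<exists>m. x \<in> S n m)" for x
    unfolding frequently_at_0_iff S_def mem_Collect_eq using R_Un by blast
  have "{x\<in>B. \<forall>\<^sub>F r in at 0. x + r *\<^sub>R u \<notin> B} = B - (\<Inter>n. \<Union>m. S n m)"
    by (simp add: set_eq_iff flip: freq) (simp add: frequently_def)
  moreover have "(\<Inter>n. \<Union>m. S n m) \<in> sets borel"
    by (intro sets.countable_INT sets.countable_UN image_subsetI S) simp
  ultimately show "{x\<in>B. \<forall>\<^sub>F r in at 0. x + r *\<^sub>R u \<notin> B} \<in> sets borel"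
    using borel_closed[OF \<open>closed B\<close>] by (simp only: sets.Diff)
  fix x
  let ?T = "{t. x + t *\<^sub>R u \<in> B}"
  have "{t. x + t *\<^sub>R u \<in> {x\<in>B. \<forall>\<^sub>F r in at 0. x + r *\<^sub>R u \<notin> B}} \<subseteq> {t\<in>?T. \<not> t islimpt ?T}"
  proof safe
    fix t assume "\<forall>\<^sub>F r in at 0. x + t *\<^sub>R u + r *\<^sub>R u \<notin> B" "t islimpt ?T"
    then show False
      unfolding islimpt_iff_eventually eventually_at_to_0[of _ t]
      by (simp add: scaleR_add_left add.assoc add.commute[of "t *\<^sub>R u"])
  qed
  then have "countable {t. x + t *\<^sub>R u \<in> {x\<in>B. \<forall>\<^sub>F r in at 0. x + r *\<^sub>R u \<notin> B}}"
    by (rule countable_subset[OF _ countable_isolated_points])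
  from null_sets_completionI[OF countable_imp_null_set_lborel[OF this]]
  show "negligible {t. x + t *\<^sub>R u \<in> {x\<in>B. \<forall>\<^sub>F r in at 0. x + r *\<^sub>R u \<notin> B}}"
    unfolding negligible_iff_null_sets .
qed

lemma negligible_directional_derivative_not_additive:
  fixes f :: "'a::euclidean_space \<Rightarrow> real"
  assumes f: "continuous_on UNIV f"
  shows "\<exists>N. negligible N \<and> (\<forall>x d\<^sub>1 d\<^sub>2 d\<^sub>3. x \<notin> N \<longrightarrow> (diff_quot f u x \<longlongrightarrow> d\<^sub>1) (at 0) \<longrightarrow>
      (diff_quot f v x \<longlongrightarrow> d\<^sub>2) (at 0) \<longrightarrow> (diff_quot f (u + v) x \<longlongrightarrow> d\<^sub>3) (at 0) \<longrightarrow> d\<^sub>3 = d\<^sub>1 + d\<^sub>2)"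
proof -
  \<comment> \<open>On \<open>B b n m\<close> the difference quotients in direction \<open>v\<close> are close to \<open>b\<close> at the uniform scale
    \<open>1 / Suc m\<close>. If \<open>x + r u\<close> returns to this set for arbitrarily small \<open>r\<close>, the increment along
    \<open>u + v\<close> splits as one along \<open>u\<close> at \<open>x\<close> and one along \<open>v\<close> at \<open>x + r u\<close>.\<close>
  define B where "B b n m = (\<Inter>r\<in>{r. \<bar>r\<bar> \<le> inverse (real (Suc m))}.
      {x. \<bar>f (x + r *\<^sub>R v) - f x - r * b\<bar> \<le> inverse (real (Suc n)) * \<bar>r\<bar>})" for b and n m :: nat
  have "closed (B b n m)" for b n m
    unfolding B_def
    by (intro closed_INT ballI closed_Collect_le continuous_intros continuous_on_compose2[OF f] f) auto
  then have "negligible (\<Union>b\<in>\<rat>. \<Union>n. \<Union>m. {x\<in>B b n m. \<forall>\<^sub>F r in at 0. x + r *\<^sub>R u \<notin> B b n m})"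
    by (intro negligible_countable_UN countable_rat negligible_isolated_on_lines) auto
  moreover have "d\<^sub>3 = d\<^sub>1 + d\<^sub>2"
    if x: "x \<notin> (\<Union>b\<in>\<rat>. \<Union>n. \<Union>m. {x\<in>B b n m. \<forall>\<^sub>F r in at 0. x + r *\<^sub>R u \<notin> B b n m})"
      and d: "(diff_quot f u x \<longlongrightarrow> d\<^sub>1) (at 0)" "(diff_quot f v x \<longlongrightarrow> d\<^sub>2) (at 0)" "(diff_quot f (u + v) x \<longlongrightarrow> d\<^sub>3) (at 0)"
    for x d\<^sub>1 d\<^sub>2 d\<^sub>3
  proof -
    have "\<bar>d\<^sub>3 - (d\<^sub>1 + d\<^sub>2)\<bar> \<le> 0 + e" if "e > 0" for e
    proof -
      \<comment> \<open>Four errors below \<open>e / 4\<close> will be added: the quotients along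
        \<open>u\<close> and \<open>u + v\<close> against their limits, the quotient along
        \<open>v\<close> against \<open>b\<close>, and \<open>b\<close> against
        \<open>d\<^sub>2\<close>.\<close>
      obtain n where n: "inverse (real (Suc n)) < e / 4" using reals_Archimedean[of "e / 4"] \<open>e > 0\<close> by auto
      define \<eta> where "\<eta> = inverse (real (Suc n))"
      have "\<eta> > 0" by (simp add: \<eta>_def)
      \<comment> \<open>The slope is approximated by a rational because the excluded null set ranges
        over rational \<open>b\<close> only.\<close>
      obtain b where b: "b \<in> \<rat>" "d\<^sub>2 < b" "b < d\<^sub>2 + \<eta>" using Rats_dense_in_real[of d\<^sub>2 "d\<^sub>2 + \<eta>"] \<open>\<eta> > 0\<close> by auto
      have "\<forall>\<^sub>F r in at 0. dist (diff_quot f v x r) d\<^sub>2 < \<eta> - (b - d\<^sub>2)"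
        using tendstoD[OF d(2)] b by simp
      then have "\<forall>\<^sub>F r in at 0. \<bar>diff_quot f v x r - b\<bar> < \<eta>"
        by eventually_elim (use b in \<open>auto simp: dist_real_def\<close>)
      then obtain \<delta> where \<delta>: "\<delta> > 0" "\<And>r. r \<noteq> 0 \<Longrightarrow> \<bar>r\<bar> < \<delta> \<Longrightarrow> \<bar>diff_quot f v x r - b\<bar> < \<eta>"
        by (auto simp: eventually_at dist_real_def)
      obtain m where m: "inverse (real (Suc m)) < \<delta>" using reals_Archimedean[OF \<open>\<delta> > 0\<close>] by blast
      have quot: "\<bar>f (y + r *\<^sub>R v) - f y - r * b\<bar> = \<bar>r\<bar> * \<bar>diff_quot f v y r - b\<bar>" if "r \<noteq> 0" for y r
        using that by (simp add: diff_quot_def field_simps flip: abs_mult)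
      have "x \<in> B b n m"
        unfolding B_def
      proof (intro INT_I CollectI)
        fix r :: real assume "r \<in> {r. \<bar>r\<bar> \<le> inverse (real (Suc m))}"
        then show "\<bar>f (x + r *\<^sub>R v) - f x - r * b\<bar> \<le> inverse (real (Suc n)) * \<bar>r\<bar>"
          using quot[of r x] \<delta>(2)[of r] m
          unfolding \<eta>_def[symmetric]
          by (cases "r = 0") (auto simp: mult.commute[of \<eta>] intro!: mult_left_mono)
      qed
      then have 1: "\<exists>\<^sub>F r in at 0. x + r *\<^sub>R u \<in> B b n m"
        using x b(1) by (auto simp: frequently_def)
      have "\<forall>\<^sub>F r in at (0::real). r \<noteq> 0" "\<forall>\<^sub>F r in at (0::real). \<bar>r\<bar> \<le> inverse (real (Suc m))"
        "\<forall>\<^sub>F r in at 0. \<bar>diff_quot f u x r - d\<^sub>1\<bar> < e / 4" "\<forall>\<^sub>F r in at 0. \<bar>diff_quot f (u + v) x r - d\<^sub>3\<bar> < e / 4"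
        using tendstoD[OF d(1), of "e / 4"] tendstoD[OF d(3), of "e / 4"] \<open>e > 0\<close>
        by (auto simp: dist_real_def eventually_at intro!: exI[of _ "inverse (real (Suc m))"] simp del: of_nat_Suc)
      then have "\<forall>\<^sub>F r in at 0. r \<noteq> 0 \<and> \<bar>r\<bar> \<le> inverse (real (Suc m)) \<and>
          \<bar>diff_quot f u x r - d\<^sub>1\<bar> < e / 4 \<and> \<bar>diff_quot f (u + v) x r - d\<^sub>3\<bar> < e / 4"
        by (intro eventually_conj)
      from frequently_ex[OF frequently_eventually_conj[OF 1 this]]
      obtain r where r: "x + r *\<^sub>R u \<in> B b n m" "r \<noteq> 0" "\<bar>r\<bar> \<le> inverse (real (Suc m))"
        "\<bar>diff_quot f u x r - d\<^sub>1\<bar> < e / 4" "\<bar>diff_quot f (u + v) x r - d\<^sub>3\<bar> < e / 4" by blast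
      have "\<bar>r\<bar> * \<bar>diff_quot f v (x + r *\<^sub>R u) r - b\<bar> \<le> \<bar>r\<bar> * \<eta>"
        using r(1,3) unfolding B_def quot[OF r(2), symmetric] \<eta>_def by (auto simp: mult.commute)
      then have "\<bar>diff_quot f v (x + r *\<^sub>R u) r - b\<bar> \<le> \<eta>" using r(2) by simp
      moreover have "diff_quot f (u + v) x r = diff_quot f u x r + diff_quot f v (x + r *\<^sub>R u) r"
        by (simp add: diff_quot_def algebra_simps flip: add_divide_distrib)
      ultimately show ?thesis using r(4,5) b(2,3) n unfolding \<eta>_def[symmetric] by linarith
    qed
    then show ?thesis using field_le_epsilon[of "\<bar>d\<^sub>3 - (d\<^sub>1 + d\<^sub>2)\<bar>" 0] by simp
  qed
  ultimately show ?thesis by blast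
qed

section \<open>Rademacher's theorem\<close>

lemma diff_quot_scaleR_tendsto:
  assumes "(diff_quot f v x \<longlongrightarrow> d) (at 0)"
  shows "(diff_quot f (c *\<^sub>R v) x \<longlongrightarrow> c * d) (at 0)"
proof (cases "c = 0")
  case True
  then show ?thesis by (simp add: diff_quot_def[abs_def])
next
  case False
  have "((\<lambda>r. c * r) \<longlongrightarrow> c * 0) (at 0)" by (intro tendsto_intros)
  then have "filterlim (\<lambda>r. c * r) (at 0) (at 0)"
    using False by (intro filterlim_atI) (auto simp: eventually_at_filter)
  then have "((\<lambda>r. c * diff_quot f v x (c * r)) \<longlongrightarrow> c * d) (at 0)"
    by (intro tendsto_mult_left filterlim_compose[OF assms])
  moreover have "c * diff_quot f v x (c * r) = diff_quot f (c *\<^sub>R v) x r" for r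
    using False by (simp add: diff_quot_def mult.commute)
  ultimately show ?thesis by simp
qed

text \<open>By compactness, finitely many directions from \<open>S\<close> form an
  \<open>\<eta>\<close>-net of the unit sphere, and on them the quotients converge uniformly. The
  Lipschitz bounds of \<open>f\<close> and \<open>A\<close> carry the estimate to all
  directions.\<close>

lemma has_derivative_of_dense_directions:
  fixes f :: "'a::euclidean_space \<Rightarrow> real"
  assumes f: "L-lipschitz_on UNIV f" and A: "bounded_linear A"
    and dense: "\<And>X. open X \<Longrightarrow> X \<noteq> {} \<Longrightarrow> \<exists>w\<in>S. w \<in> X"
    and dir: "\<And>w. w \<in> S \<Longrightarrow> (diff_quot f w x \<longlongrightarrow> A w) (at 0)"
  shows "(f has_derivative A) (at x)"
  unfolding has_derivative_at_alt
proof (intro conjI A allI impI)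
  interpret A: bounded_linear A by (rule A)
  fix e :: real assume "e > 0"
  obtain B where B: "B > 0" "\<And>w. norm (A w) \<le> norm w * B" using A.pos_bounded by blast
  have "L \<ge> 0" using f by (rule lipschitz_on_nonneg)
  \<comment> \<open>Three errors, at most \<open>r * \<eta>\<close> times 1, \<open>L\<close> and
    \<open>B\<close>, must add up to \<open>r * e\<close>: convergence on the net, and moving to the
    nearest net direction in \<open>f\<close> and in \<open>A\<close>.\<close>
  define \<eta> where "\<eta> = e / (1 + L + B)"
  have "\<eta> > 0" "\<eta> * (1 + L + B) = e" using \<open>e > 0\<close> \<open>L \<ge> 0\<close> \<open>B > 0\<close> by (auto simp: \<eta>_def)
  have "sphere 0 1 \<subseteq> (\<Union>w\<in>S. ball w \<eta>)"
  proof
    fix u :: 'a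
    obtain w where "w \<in> S" "w \<in> ball u \<eta>" using dense[of "ball u \<eta>"] \<open>\<eta> > 0\<close> by auto
    then show "u \<in> (\<Union>w\<in>S. ball w \<eta>)" by (auto simp: dist_commute)
  qed
  then obtain S' where S': "S' \<subseteq> S" "finite S'" "sphere 0 1 \<subseteq> (\<Union>w\<in>S'. ball w \<eta>)"
    using compactE_image[OF compact_sphere, of S "\<lambda>w. ball w \<eta>" 0 1] by blast
  have "\<forall>\<^sub>F r in at 0. \<forall>w\<in>S'. dist (diff_quot f w x r) (A w) < \<eta>"
    using S' \<open>\<eta> > 0\<close> by (intro eventually_ball_finite ballI tendstoD[OF dir]) auto
  then obtain \<delta> where \<delta>: "\<delta> > 0"
      "\<And>r w. r \<noteq> 0 \<Longrightarrow> \<bar>r\<bar> < \<delta> \<Longrightarrow> w \<in> S' \<Longrightarrow> \<bar>diff_quot f w x r - A w\<bar> < \<eta>"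
    by (auto simp: eventually_at dist_real_def)
  have "norm (f y - f x - A (y - x)) \<le> e * norm (y - x)" if "norm (y - x) < \<delta>" for y
  proof (cases "y = x")
    case True
    then show ?thesis by (simp add: A.zero)
  next
    case False
    define r where "r = norm (y - x)"
    define u where "u = (y - x) /\<^sub>R r"
    have r: "r > 0" "r < \<delta>" using False that by (auto simp: r_def)
    have u: "norm u = 1" "y = x + r *\<^sub>R u" using r by (auto simp: u_def r_def)
    then obtain w where w: "w \<in> S'" "dist w u < \<eta>" using S'(3) by (auto simp: subset_iff)
    have "\<bar>diff_quot f w x r - A w\<bar> < \<eta>" using \<delta>(2)[of r w] r w by simp
    then have "r * \<bar>diff_quot f w x r - A w\<bar> \<le> r * \<eta>" using r by (intro mult_left_mono) auto
    moreover have "r * \<bar>diff_quot f w x r - A w\<bar> = \<bar>f (x + r *\<^sub>R w) - f x - r * A w\<bar>"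
      using r by (simp add: diff_quot_def abs_mult[of r, symmetric, unfolded abs_of_pos[OF r(1)]] field_simps flip: abs_mult_pos)
    moreover have "\<bar>f y - f (x + r *\<^sub>R w)\<bar> \<le> L * (r * \<eta>)"
    proof -
      have "dist y (x + r *\<^sub>R w) = r * dist w u"
        using r by (simp add: u(2) dist_norm norm_minus_commute flip: scaleR_diff_right)
      then have "\<bar>f y - f (x + r *\<^sub>R w)\<bar> \<le> L * (r * dist w u)"
        using lipschitz_onD[OF f, of y "x + r *\<^sub>R w"] by (simp add: dist_real_def)
      also have "\<dots> \<le> L * (r * \<eta>)" using w r \<open>L \<ge> 0\<close> by (intro mult_left_mono) auto
      finally show ?thesis .
    qed
    moreover have "\<bar>r * A w - A (y - x)\<bar> \<le> r * \<eta> * B"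
    proof -
      have "r * A w - A (y - x) = A (r *\<^sub>R (w - u))"
        by (simp add: u(2) A.scaleR A.diff right_diff_distrib)
      also have "\<bar>\<dots>\<bar> \<le> norm (r *\<^sub>R (w - u)) * B" using B(2) by (metis real_norm_def)
      also have "\<dots> \<le> r * \<eta> * B" using r w B by (auto simp: dist_norm intro!: mult_right_mono)
      finally show ?thesis .
    qed
    ultimately have "\<bar>f y - f x - A (y - x)\<bar> \<le> r * \<eta> + L * (r * \<eta>) + r * \<eta> * B" by linarith
    also have "\<dots> = r * (\<eta> * (1 + L + B))" by (simp add: algebra_simps)
    finally show ?thesis unfolding \<open>\<eta> * (1 + L + B) = e\<close> by (simp add: r_def mult.commute)
  qed
  then show "\<exists>d>0. \<forall>y. norm (y - x) < d \<longrightarrow> norm (f y - f x - A (y - x)) \<le> e * norm (y - x)"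
    using \<delta>(1) by blast
qed

text \<open>Outside a null set, directional derivatives exist and add up for countably many
  directions. This makes them linear on a dense set of directions, which suffices by the previous
  lemma.\<close>

theorem rademacher:
  fixes f :: "'a::euclidean_space \<Rightarrow> real"
  assumes f: "L-lipschitz_on UNIV f"
  shows "negligible {x. \<not> f differentiable at x}"
proof -
  obtain S :: "'a set" where S: "countable S" "\<And>X. open X \<Longrightarrow> X \<noteq> {} \<Longrightarrow> \<exists>w\<in>S. w \<in> X"
    using countable_dense_exists[where 'a = 'a] by blast
  \<comment> \<open>The countable set \<open>C\<close> contains every partial coordinate sum of each
    dense \<open>w\<close>. The derivative along \<open>w\<close> can thus be assembled one
    coordinate at a time, with additivity used only for pairs from \<open>C\<close>.\<close>
  define trunc where "trunc w F = (\<Sum>b\<in>F. (w \<bullet> b) *\<^sub>R b)" for w :: 'a and F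
  define C where "C = (\<lambda>(w, F). trunc w F) ` (S \<times> Pow Basis) \<union> Basis"
  have "countable C"
    unfolding C_def using S(1) by (intro countable_Un countable_image countable_SIGMA) (auto intro: countable_finite)
  have trunc_C: "trunc w F \<in> C" if "w \<in> S" "F \<subseteq> Basis" for w F
    using that by (force simp: C_def)
  have "\<exists>M. \<forall>u v. negligible (M u v) \<and> (\<forall>x d\<^sub>1 d\<^sub>2 d\<^sub>3. x \<notin> M u v \<longrightarrow> (diff_quot f u x \<longlongrightarrow> d\<^sub>1) (at 0) \<longrightarrow>
      (diff_quot f v x \<longlongrightarrow> d\<^sub>2) (at 0) \<longrightarrow> (diff_quot f (u + v) x \<longlongrightarrow> d\<^sub>3) (at 0) \<longrightarrow> d\<^sub>3 = d\<^sub>1 + d\<^sub>2)"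
    using negligible_directional_derivative_not_additive[OF lipschitz_on_continuous_on[OF f]] by metis
  then obtain M where M: "\<And>u v. negligible (M u v)"
    "\<And>u v x d\<^sub>1 d\<^sub>2 d\<^sub>3. x \<notin> M u v \<Longrightarrow> (diff_quot f u x \<longlongrightarrow> d\<^sub>1) (at 0) \<Longrightarrow>
      (diff_quot f v x \<longlongrightarrow> d\<^sub>2) (at 0) \<Longrightarrow> (diff_quot f (u + v) x \<longlongrightarrow> d\<^sub>3) (at 0) \<Longrightarrow> d\<^sub>3 = d\<^sub>1 + d\<^sub>2"
    by blast
  define N where "N = (\<Union>v\<in>C. {x. \<nexists>d. (diff_quot f v x \<longlongrightarrow> d) (at 0)}) \<union> (\<Union>u\<in>C. \<Union>v\<in>C. M u v)"
  have "negligible N"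
    unfolding N_def using \<open>countable C\<close>
    by (intro negligible_Un negligible_countable_UN negligible_no_directional_derivative[OF f] M(1))
  moreover have "f differentiable at x" if "x \<notin> N" for x
  proof -
    have "\<forall>v\<in>C. \<exists>d. (diff_quot f v x \<longlongrightarrow> d) (at 0)" using that by (auto simp: N_def)
    then obtain D where D: "\<And>v. v \<in> C \<Longrightarrow> (diff_quot f v x \<longlongrightarrow> D v) (at 0)" by metis
    have trunc_D: "D (trunc w F) = (\<Sum>b\<in>F. (w \<bullet> b) * D b)" if "w \<in> S" "finite F" "F \<subseteq> Basis" for w F
      using that(2,3)
    proof (induction F rule: finite_induct)
      case empty
      have "0 \<in> C" using trunc_C[OF \<open>w \<in> S\<close>, of "{}"] by (simp add: trunc_def)
      moreover have "(diff_quot f 0 x \<longlongrightarrow> 0) (at 0)" by (simp add: diff_quot_def[abs_def])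
      ultimately show ?case
        using tendsto_unique[OF _ D[of 0]] by (simp add: trunc_def)
    next
      case (insert b F)
      have "(w \<bullet> b) *\<^sub>R b = trunc w {b}" by (simp add: trunc_def)
      then have C: "(w \<bullet> b) *\<^sub>R b \<in> C" "trunc w F \<in> C" "trunc w (insert b F) \<in> C"
        using trunc_C[OF \<open>w \<in> S\<close>] insert.prems by auto
      have sum: "trunc w (insert b F) = (w \<bullet> b) *\<^sub>R b + trunc w F"
        using insert.hyps by (simp add: trunc_def)
      have "b \<in> C" using insert.prems by (simp add: C_def)
      have "x \<notin> M ((w \<bullet> b) *\<^sub>R b) (trunc w F)" using \<open>x \<notin> N\<close> C by (auto simp: N_def)
      from M(2)[OF this diff_quot_scaleR_tendsto[OF D[OF \<open>b \<in> C\<close>]] D[OF C(2)] D[OF C(3), unfolded sum]]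
      show ?case using insert by (simp add: sum)
    qed
    define A where "A w = (\<Sum>b\<in>Basis. (w \<bullet> b) * D b)" for w
    have "bounded_linear A"
      unfolding A_def
      by (intro bounded_linear_sum bounded_linear_mult_const bounded_linear_inner_left)
    then have "(f has_derivative A) (at x)"
    proof (rule has_derivative_of_dense_directions[OF f _ S(2)])
      fix w assume "w \<in> S"
      have "trunc w Basis = w" by (simp add: trunc_def euclidean_representation)
      then show "(diff_quot f w x \<longlongrightarrow> A w) (at 0)"
        using D[OF trunc_C[OF \<open>w \<in> S\<close>, of Basis]] trunc_D[OF \<open>w \<in> S\<close>, of Basis] by (simp add: A_def)
    qed
    then show ?thesis by (rule differentiableI)
  qed
  ultimately show ?thesis by (auto intro: negligible_subset)
qed

section \<open>Bounding difference quotients by derivatives\<close>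

lemma has_derivative_diff_quot:
  assumes "(f has_derivative D) (at x)"
  shows "(diff_quot f v x \<longlongrightarrow> D v) (at 0)"
proof -
  interpret D: bounded_linear D using assms by (rule has_derivative_bounded_linear)
  have "((\<lambda>r. f (x + r *\<^sub>R v)) has_derivative (\<lambda>r. D (r *\<^sub>R v))) (at 0)"
    by (rule has_derivative_compose[of "\<lambda>r. x + r *\<^sub>R v" _ 0 UNIV f]) (auto intro!: derivative_eq_intros simp: assms)
  then have "((\<lambda>r. f (x + r *\<^sub>R v)) has_field_derivative D v) (at 0)"
    by (simp add: has_field_derivative_def D.scaleR ext[of "(*) (D v)" "\<lambda>r. r * D v"])
  then show ?thesis
    by (simp add: DERIV_def diff_quot_def[abs_def])
qed

text \<open>The segment from \<open>z\<close> itself may consist of points of nondifferentiability.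
  But the points near \<open>y\<close> violating the bound form an open set, which has positive
  measure if nonempty. Almost every segment in direction \<open>h\<close> is good at almost all its
  points, and there the mean value bound refutes the violation. The two halves of
  \<open>\<rho>\<close> are spent on the base point and on the segment.\<close>

lemma diff_quot_le_of_derivative_le:
  fixes f :: "'a::euclidean_space \<Rightarrow> real"
  assumes f: "L-lipschitz_on UNIV f"
    and deriv: "\<And>z D. z \<in> ball y \<rho> \<Longrightarrow> (f has_derivative D) (at z) \<Longrightarrow> D h \<le> c"
    and z: "z \<in> ball y (\<rho> / 2)" and t: "0 < t" "t * norm h < \<rho> / 2"
  shows "diff_quot f h z t \<le> c"
proof (rule ccontr)
  assume contra: "\<not> diff_quot f h z t \<le> c"
  have cf: "continuous_on UNIV f" using f by (rule lipschitz_on_continuous_on)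
  define W where "W = ball y (\<rho> / 2) \<inter> {z. c < diff_quot f h z t}"
  have "open W"
    unfolding W_def diff_quot_def divide_inverse
    by (intro open_Int open_ball open_Collect_less continuous_intros continuous_on_compose2[OF cf]) auto
  moreover have "W \<noteq> {}" using z contra by (auto simp: W_def)
  ultimately have "\<not> negligible W" by (rule open_not_negligible)
  define N where "N = {x. \<not> f differentiable at x}"
  have "negligible N" unfolding N_def using f by (rule rademacher)
  have "W \<subseteq> {w. \<not> negligible {s. w + s *\<^sub>R h \<in> N}}"
  proof (intro subsetI CollectI notI)
    fix w assume "w \<in> W" and negl: "negligible {s. w + s *\<^sub>R h \<in> N}"
    let ?g = "\<lambda>s. f (w + s *\<^sub>R h)"
    have "(norm h)-lipschitz_on UNIV (\<lambda>s. w + s *\<^sub>R h)"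
      by (rule lipschitz_onI) (auto simp: dist_norm mult.commute simp flip: scaleR_diff_left)
    then have g: "(L * norm h)-lipschitz_on UNIV ?g"
      using lipschitz_on_compose2[of "norm h" UNIV _ L f] lipschitz_on_subset[OF f] by (simp add: mult.commute)
    \<comment> \<open>The slack \<open>e\<close> is needed because a derivative at most
      \<open>c\<close> only forces nearby quotients below \<open>c + e\<close>.\<close>
    have "?g t - ?g 0 \<le> (c + e) * (t - 0)" if "e > 0" for e
    proof (rule mean_value_le_except_negligible[OF g negl])
      fix s assume s: "s \<in> {0..t} - {s. w + s *\<^sub>R h \<in> N}"
      then obtain D where D: "(f has_derivative D) (at (w + s *\<^sub>R h))"
        by (auto simp: N_def differentiable_def)
      have "dist y (w + s *\<^sub>R h) \<le> dist y w + norm (s *\<^sub>R h)"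
        using dist_triangle[of y "w + s *\<^sub>R h" w] by (simp add: dist_norm)
      also have "norm (s *\<^sub>R h) \<le> t * norm h" using s by (auto intro: mult_right_mono)
      finally have "w + s *\<^sub>R h \<in> ball y \<rho>" using \<open>w \<in> W\<close> t by (simp add: W_def)
      then have "D h < c + e" using deriv[OF _ D] \<open>e > 0\<close> by fastforce
      then have "\<forall>\<^sub>F r in at 0. diff_quot f h (w + s *\<^sub>R h) r < c + e"
        by (rule order_tendstoD(2)[OF has_derivative_diff_quot[OF D]])
      then have "\<forall>\<^sub>F r in at_right 0. (?g (s + r) - ?g s) / r \<le> c + e"
        by (auto simp: eventually_at_split diff_quot_def algebra_simps elim: eventually_mono)
      then show "\<exists>\<^sub>F r in at_right 0. (?g (s + r) - ?g s) / r \<le> c + e"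
        by (rule eventually_frequently[rotated]) simp
    qed (use t in simp)
    then have "diff_quot f h w t \<le> c + e" if "e > 0" for e
      using t that by (simp add: diff_quot_def pos_divide_le_eq)
    then have "diff_quot f h w t \<le> c" by (rule field_le_epsilon)
    then show False using \<open>w \<in> W\<close> by (simp add: W_def)
  qed
  moreover have "negligible {w. \<not> negligible {s::real. w + s *\<^sub>R h \<in> N}}"
  proof -
    obtain Z where Z: "{w \<in> space lborel. \<not> negligible {s::real. w + s *\<^sub>R h \<in> N}} \<subseteq> Z"
        "emeasure lborel Z = 0" "Z \<in> sets lborel"
      using AE_E[OF AE_negligible_on_lines[OF \<open>negligible N\<close>]] .
    then have "negligible Z" by (simp add: negligible_borel_iff)
    then show ?thesis using Z(1) by (auto intro: negligible_subset)
  qed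
  ultimately show False using \<open>\<not> negligible W\<close> negligible_subset by blast
qed

section \<open>Clarke's directional derivative and the generalized gradients\<close>

lemma clarke_dderiv_le:
  assumes "\<delta> > 0" "\<delta>' > 0"
    and "\<And>z t. z \<in> ball y \<delta> \<Longrightarrow> 0 < t \<Longrightarrow> t < \<delta>' \<Longrightarrow> diff_quot f h z t \<le> c"
  shows "clarke_dderiv f y h \<le> ereal c"
proof -
  have "\<forall>\<^sub>F z in nhds y. z \<in> ball y \<delta>"
    using \<open>\<delta> > 0\<close> by (intro eventually_nhds_in_open) auto
  moreover have "\<forall>\<^sub>F t in at_right 0. t \<in> {0<..<\<delta>'}"
    using \<open>\<delta>' > 0\<close> by (rule eventually_at_right_real)
  ultimately have "\<forall>\<^sub>F (z, t) in nhds y \<times>\<^sub>F at_right 0. ereal ((f (z + t *\<^sub>R h) - f z) / t) \<le> ereal c"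
    unfolding eventually_prod_filter using assms(3) unfolding diff_quot_def
    by (intro exI[of _ "\<lambda>z. z \<in> ball y \<delta>"] exI[of _ "\<lambda>t. t \<in> {0<..<\<delta>'}"]) auto
  then show ?thesis
    unfolding clarke_dderiv_def by (intro Limsup_bounded) (simp add: case_prod_beta')
qed

text \<open>The upper limit bounds quotients at all base points near \<open>y\<close> at once;
  fixing such a point \<open>z\<close> and letting \<open>t\<close> tend to 0 bounds the derivative
  there. This is the form in which upper semicontinuity is used.\<close>

lemma derivative_le_of_clarke_dderiv_less:
  assumes "clarke_dderiv f y h < ereal c"
  shows "\<exists>\<delta>>0. \<forall>z\<in>ball y \<delta>. \<forall>D. (f has_derivative D) (at z) \<longrightarrow> D h \<le> c"
proof -
  have "\<forall>\<^sub>F (z, t) in nhds y \<times>\<^sub>F at_right 0. ereal ((f (z + t *\<^sub>R h) - f z) / t) < ereal c"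
    using Limsup_lessD[OF assms[unfolded clarke_dderiv_def]] by (simp add: case_prod_beta')
  then obtain P Q where PQ: "eventually P (nhds y)" "eventually Q (at_right 0)"
      "\<And>z t. P z \<Longrightarrow> Q t \<Longrightarrow> diff_quot f h z t < c"
    unfolding eventually_prod_filter diff_quot_def by auto
  obtain \<delta> where \<delta>: "\<delta> > 0" "\<And>z. z \<in> ball y \<delta> \<Longrightarrow> P z"
    using PQ(1) by (auto simp: eventually_nhds_metric dist_commute)
  have "D h \<le> c" if "z \<in> ball y \<delta>" "(f has_derivative D) (at z)" for z D
  proof (rule tendsto_upperbound)
    show "(diff_quot f h z \<longlongrightarrow> D h) (at_right 0)"
      by (rule filterlim_mono[OF has_derivative_diff_quot[OF that(2)] order_refl at_le]) simp
    show "\<forall>\<^sub>F t in at_right 0. diff_quot f h z t \<le> c"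
      using PQ(2) by eventually_elim (use PQ(3) \<delta>(2)[OF that(1)] in \<open>auto intro: less_imp_le\<close>)
  qed simp
  then show ?thesis using \<delta>(1) by blast
qed

section \<open>Compactness and separation in the dual space\<close>

text \<open>The Riesz isomorphism, with inverse \<open>blinfun_inner_right\<close>. It transports
  compactness of convex hulls and hyperplane separation from the Euclidean space to its
  dual.\<close>

definition gradient_vector :: "('a::euclidean_space \<Rightarrow>\<^sub>L real) \<Rightarrow> 'a"
  where "gradient_vector D = (\<Sum>b\<in>Basis. D b *\<^sub>R b)"

lemma bounded_linear_gradient_vector: "bounded_linear gradient_vector"
  unfolding gradient_vector_def
  by (intro bounded_linear_sum bounded_linear_scaleR_const blinfun.bounded_linear_left)

lemma inner_gradient_vector: "gradient_vector D \<bullet> h = D h"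
proof -
  have "D h = D (\<Sum>b\<in>Basis. (h \<bullet> b) *\<^sub>R b)" by (simp add: euclidean_representation)
  also have "\<dots> = (\<Sum>b\<in>Basis. (h \<bullet> b) * D b)" by (simp add: blinfun.sum_right blinfun.scaleR_right)
  finally have eq: "D h = (\<Sum>b\<in>Basis. (h \<bullet> b) * D b)" .
  show ?thesis
    unfolding gradient_vector_def inner_sum_left eq by (simp add: inner_commute[of h] mult.commute)
qed

lemma blinfun_inner_right_gradient_vector: "blinfun_inner_right (gradient_vector D) = D"
  by (rule blinfun_eqI) (simp add: inner_gradient_vector)

lemma gradient_vector_blinfun_inner_right: "gradient_vector (blinfun_inner_right a) = a"
  by (simp add: gradient_vector_def euclidean_representation)

lemma image_gradient_vector_eq_vimage: "gradient_vector ` A = blinfun_inner_right -` A"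
proof (intro set_eqI iffI)
  fix a assume "a \<in> blinfun_inner_right -` A"
  then show "a \<in> gradient_vector ` A" by (metis gradient_vector_blinfun_inner_right image_eqI vimageD)
qed (auto simp: blinfun_inner_right_gradient_vector)

lemma compact_convex_hull_blinfun:
  fixes A :: "('a::euclidean_space \<Rightarrow>\<^sub>L real) set"
  assumes "compact A"
  shows "compact (convex hull A)"
proof -
  have "compact (convex hull (gradient_vector ` A))"
    using assms by (intro compact_convex_hull compact_continuous_image
      linear_continuous_on bounded_linear_gradient_vector)
  then have "compact (blinfun_inner_right ` (convex hull (gradient_vector ` A)))"
    by (intro compact_continuous_image linear_continuous_on bounded_linear_blinfun_inner_right)
  moreover have "blinfun_inner_right ` (convex hull (gradient_vector ` A)) = convex hull A"
    by (simp add: convex_hull_linear_image bounded_linear.linear[OF bounded_linear_blinfun_inner_right]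
        image_image blinfun_inner_right_gradient_vector)
  ultimately show ?thesis by simp
qed

lemma separating_direction:
  fixes C :: "('a::euclidean_space \<Rightarrow>\<^sub>L real) set"
  assumes "convex C" "closed C" "a \<notin> C"
  obtains h \<beta> where "\<And>c. c \<in> C \<Longrightarrow> blinfun_apply c h < \<beta>" "\<beta> < blinfun_apply a h"
proof -
  have "convex (gradient_vector ` C)"
    by (intro convex_linear_image assms bounded_linear.linear bounded_linear_gradient_vector)
  moreover have "closed (gradient_vector ` C)"
    unfolding image_gradient_vector_eq_vimage
    by (intro continuous_closed_vimage assms linear_continuous_at bounded_linear_blinfun_inner_right)
  moreover have "gradient_vector a \<notin> gradient_vector ` C"
    using assms(3) by (simp add: image_gradient_vector_eq_vimage blinfun_inner_right_gradient_vector)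
  ultimately obtain u b where *: "u \<bullet> gradient_vector a < b" "\<forall>x\<in>gradient_vector ` C. b < u \<bullet> x"
    using separating_hyperplane_closed_point by blast
  show ?thesis
  \<comment> \<open>The hyperplane theorem places the point below and the set above, so the signs
    are reversed.\<close>
  proof (rule that[of "- u" "- b"])
    show "blinfun_apply c (- u) < - b" if "c \<in> C" for c
      using *(2) that by (auto simp: blinfun.minus_right inner_commute[of u] inner_gradient_vector)
    show "- b < blinfun_apply a (- u)"
      using *(1) by (simp add: blinfun.minus_right inner_commute[of u] inner_gradient_vector)
  qed
qed

section \<open>Limits of derivatives and Clarke subgradients\<close>

definition derivatives_on :: "('a::euclidean_space \<Rightarrow> real) \<Rightarrow> 'a set \<Rightarrow> ('a \<Rightarrow>\<^sub>L real) set"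
  where "derivatives_on f A = {D. \<exists>y\<in>A. (f has_derivative blinfun_apply D) (at y)}"

lemma norm_derivative_le_lipschitz:
  assumes "L-lipschitz_on UNIV f" "D \<in> derivatives_on f A"
  shows "norm D \<le> L"
proof (rule norm_blinfun_bound)
  fix h
  obtain y where "(f has_derivative blinfun_apply D) (at y)" using assms(2) by (auto simp: derivatives_on_def)
  then have "((\<lambda>r. \<bar>diff_quot f h y r\<bar>) \<longlongrightarrow> \<bar>D h\<bar>) (at 0)"
    by (intro tendsto_rabs has_derivative_diff_quot)
  then have "\<bar>D h\<bar> \<le> L * norm h"
    by (rule tendsto_upperbound) (auto intro: abs_diff_quot_le[OF assms(1)] always_eventually)
  then show "norm (blinfun_apply D h) \<le> L * norm h" by simp
qed (rule lipschitz_on_nonneg[OF assms(1)])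

lemma goldstein_gradient_altdef:
  "goldstein_gradient \<epsilon> f x = convex hull (\<Inter>n. closure (derivatives_on f (cball x (\<epsilon> + inverse (real (Suc n))))))"
proof -
  have "(\<Inter>k\<in>{1::nat..}. closure (derivatives_on f (cball x (\<epsilon> + 1 / real k)))) =
      (\<Inter>n. closure (derivatives_on f (cball x (\<epsilon> + inverse (real (Suc n))))))"
  proof -
    have "{1::nat..} = range Suc" by (auto simp: image_iff) (metis Suc_le_D)
    then show ?thesis by (simp add: image_image inverse_eq_divide)
  qed
  then show ?thesis by (simp add: goldstein_gradient_def derivatives_on_def)
qed

lemma derivative_limit_in_clarke_gradient:
  fixes f :: "'a::euclidean_space \<Rightarrow> real"
  assumes "\<epsilon> \<ge> 0" and D: "\<And>n. D \<in> closure (derivatives_on f (cball x (\<epsilon> + inverse (real (Suc n)))))"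
  shows "\<exists>y\<in>cball x \<epsilon>. D \<in> clarke_gradient f y"
proof -
  \<comment> \<open>Diagonal choice: at stage \<open>n\<close> both the distance to \<open>D\<close>
    and the enlargement of the ball are controlled by \<open>1 / (n + 1)\<close>, so
    \<open>D\<close> is the limit of derivatives at points whose cluster points lie in the ball of
    radius \<open>\<epsilon>\<close>.\<close>
  have "\<exists>E y. dist E D < inverse (real (Suc n)) \<and> y \<in> cball x (\<epsilon> + inverse (real (Suc n))) \<and>
      (f has_derivative blinfun_apply E) (at y)" for n
  proof -
    have "inverse (real (Suc n)) > 0" by simp
    then show ?thesis
      using D[of n] unfolding closure_approachable derivatives_on_def mem_Collect_eq by blast
  qed
  then obtain E y where E: "\<And>n. dist (E n) D < inverse (real (Suc n))"
    and y: "\<And>n. y n \<in> cball x (\<epsilon> + inverse (real (Suc n)))"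
    and deriv: "\<And>n. (f has_derivative blinfun_apply (E n)) (at (y n))"
    by metis
  have "y n \<in> cball x (\<epsilon> + 1)" for n
  proof -
    have "inverse (real (Suc n)) \<le> 1" by (simp add: inverse_le_1_iff)
    then show ?thesis using y[of n] by (simp del: of_nat_Suc)
  qed
  then obtain l r where r: "strict_mono r" "(y \<circ> r) \<longlonglongrightarrow> l"
    using compact_cball[of x "\<epsilon> + 1"] unfolding compact_def by metis
  have inv: "(\<lambda>n. inverse (real (Suc (r n)))) \<longlonglongrightarrow> 0"
    using LIMSEQ_subseq_LIMSEQ[OF LIMSEQ_inverse_real_of_nat r(1)] by (simp add: o_def)
  have "E \<longlonglongrightarrow> D"
    by (rule metric_tendsto_imp_tendsto[OF LIMSEQ_inverse_real_of_nat])
      (auto intro!: always_eventually less_imp_le E[THEN less_le_trans] simp del: of_nat_Suc)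
  then have Er: "(\<lambda>n. blinfun_apply (E (r n)) h) \<longlonglongrightarrow> blinfun_apply D h" for h
    by (intro tendsto_intros LIMSEQ_subseq_LIMSEQ[OF _ r(1), unfolded o_def])
  have "dist x l \<le> \<epsilon> + 0"
  proof (rule tendsto_le[OF sequentially_bot])
    show "(\<lambda>n. dist x (y (r n))) \<longlonglongrightarrow> dist x l"
      using r(2) by (intro tendsto_intros) (simp add: o_def)
    show "(\<lambda>n. \<epsilon> + inverse (real (Suc (r n)))) \<longlonglongrightarrow> \<epsilon> + 0" by (intro tendsto_intros inv)
    show "\<forall>\<^sub>F n in sequentially. dist x (y (r n)) \<le> \<epsilon> + inverse (real (Suc (r n)))"
      using y by (simp del: of_nat_Suc)
  qed
  moreover have "D \<in> clarke_gradient f l"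
    unfolding clarke_gradient_def
  proof (intro CollectI allI, rule ccontr)
    fix h assume "\<not> ereal (blinfun_apply D h) \<le> clarke_dderiv f l h"
    then have "clarke_dderiv f l h < ereal (blinfun_apply D h)" by simp
    \<comment> \<open>A level strictly in between gives the strict inequality needed near
      \<open>l\<close> and still contradicts the limit of the weak bounds.\<close>
    then obtain c where c: "clarke_dderiv f l h < ereal c" "c < blinfun_apply D h"
      using ereal_dense2 less_ereal.simps(1) by blast
    obtain \<delta> where \<delta>: "\<delta> > 0" "\<And>z D. z \<in> ball l \<delta> \<Longrightarrow> (f has_derivative D) (at z) \<Longrightarrow> D h \<le> c"
      using derivative_le_of_clarke_dderiv_less[OF c(1)] by blast
    have "\<forall>\<^sub>F n in sequentially. y (r n) \<in> ball l \<delta>"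
      using tendstoD[OF r(2) \<delta>(1)] by (simp add: dist_commute)
    then have "\<forall>\<^sub>F n in sequentially. blinfun_apply (E (r n)) h \<le> c"
      by eventually_elim (use \<delta>(2) deriv in blast)
    then have "blinfun_apply D h \<le> c"
      by (rule tendsto_upperbound[OF Er]) simp
    then show False using c(2) by simp
  qed
  ultimately show ?thesis by auto
qed

lemma goldstein_gradient_eq_gradient_on_lipschitz:
  fixes f :: "'a::euclidean_space \<Rightarrow> real"
  assumes f: "L-lipschitz_on UNIV f" and "\<epsilon> \<ge> 0"
  shows "goldstein_gradient \<epsilon> f x = gradient_on f (cball x \<epsilon>)"
proof -
  define G where "G n = closure (derivatives_on f (cball x (\<epsilon> + inverse (real (Suc n)))))" for n
  have cG: "compact (G n)" for n
  proof -
    have "bounded (derivatives_on f (cball x (\<epsilon> + inverse (real (Suc n)))))"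
      using norm_derivative_le_lipschitz[OF f] by (intro boundedI)
    then show ?thesis unfolding G_def by (simp add: compact_closure)
  qed
  have antimono: "G n \<subseteq> G m" if "m \<le> n" for m n
  proof -
    have "inverse (real (Suc n)) \<le> inverse (real (Suc m))" using that by (simp add: inverse_le_iff_le)
    then have "cball x (\<epsilon> + inverse (real (Suc n))) \<subseteq> cball x (\<epsilon> + inverse (real (Suc m)))"
      by (intro subset_cball) simp
    then show ?thesis unfolding G_def derivatives_on_def by (intro closure_mono) blast
  qed
  \<comment> \<open>In finite dimension the hull of a compact set is compact, so it is closed and
    can absorb the closure in \<open>gradient_on\<close>.\<close>
  have "compact (\<Inter>n. G n)" using cG by (intro compact_Inter) auto
  then have closed: "closed (convex hull (\<Inter>n. G n))"
    by (intro compact_imp_closed compact_convex_hull_blinfun)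
  have "clarke_gradient f y \<subseteq> convex hull (\<Inter>n. G n)" if y: "y \<in> cball x \<epsilon>" for y
  proof (rule subsetI, rule ccontr)
    fix a assume a: "a \<in> clarke_gradient f y" "a \<notin> convex hull (\<Inter>n. G n)"
    obtain h \<beta> where h: "\<And>c. c \<in> convex hull (\<Inter>n. G n) \<Longrightarrow> blinfun_apply c h < \<beta>" "\<beta> < blinfun_apply a h"
      using separating_direction[OF convex_convex_hull closed a(2)] by blast
    \<comment> \<open>Cantor intersection: if every \<open>G n\<close> met the closed half-space, so
      would their intersection, contrary to the separation. The bound thus already holds at one
      positive radius.\<close>
    have "\<exists>n. G n \<inter> {c. \<beta> \<le> blinfun_apply c h} = {}"
    proof (rule ccontr)
      assume "\<nexists>n. G n \<inter> {c. \<beta> \<le> blinfun_apply c h} = {}"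
      moreover have "closed {c::'a \<Rightarrow>\<^sub>L real. \<beta> \<le> blinfun_apply c h}"
        by (intro closed_Collect_le continuous_intros)
      ultimately have "(\<Inter>n. G n \<inter> {c. \<beta> \<le> blinfun_apply c h}) \<noteq> {}"
        using antimono by (intro compact_nest compact_Int_closed cG) blast+
      then obtain c where "c \<in> (\<Inter>n. G n)" "\<beta> \<le> blinfun_apply c h" by blast
      then show False using h(1)[of c] hull_inc[of c "\<Inter>n. G n" convex] by auto
    qed
    then obtain n where n: "\<And>c. c \<in> G n \<Longrightarrow> blinfun_apply c h < \<beta>" by force
    define \<rho> where "\<rho> = inverse (real (Suc n))"
    have "\<rho> > 0" by (simp add: \<rho>_def)
    have deriv: "D h \<le> \<beta>" if "z \<in> ball y \<rho>" and D: "(f has_derivative D) (at z)" for z D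
    proof -
      have "z \<in> cball x (\<epsilon> + \<rho>)" using dist_triangle[of x z y] that(1) y by simp
      then have "Blinfun D \<in> G n"
        unfolding G_def \<rho>_def derivatives_on_def using D
        by (auto intro!: subsetD[OF closure_subset] bexI[of _ z] simp: bounded_linear_Blinfun_apply has_derivative_bounded_linear)
      from n[OF this] show ?thesis
        using D by (simp add: bounded_linear_Blinfun_apply has_derivative_bounded_linear)
    qed
    have "clarke_dderiv f y h \<le> ereal \<beta>"
    proof (rule clarke_dderiv_le)
      \<comment> \<open>The bound on \<open>t\<close> ensures
        \<open>t * norm h < \<rho> / 2\<close>; the summand 1 takes care of
        \<open>h = 0\<close>.\<close>
      show "\<rho> / 2 > 0" "\<rho> / 2 / (norm h + 1) > 0" using \<open>\<rho> > 0\<close> by (auto intro!: divide_pos_pos add_nonneg_pos)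
      show "diff_quot f h z t \<le> \<beta>" if "z \<in> ball y (\<rho> / 2)" "0 < t" "t < \<rho> / 2 / (norm h + 1)" for z t
      proof (rule diff_quot_le_of_derivative_le[OF f deriv that(1,2)])
        have "t * norm h \<le> t * (norm h + 1)" using \<open>0 < t\<close> by simp
        also have "\<dots> < \<rho> / 2" using that(3) by (subst (asm) pos_less_divide_eq) (simp_all add: add_nonneg_pos)
        finally show "t * norm h < \<rho> / 2" .
      qed
    qed
    moreover have "ereal (blinfun_apply a h) \<le> clarke_dderiv f y h"
      using a(1) by (simp add: clarke_gradient_def)
    ultimately show False using h(2) by (meson ereal_less_eq(3) not_le order_trans)
  qed
  then have "gradient_on f (cball x \<epsilon>) \<subseteq> convex hull (\<Inter>n. G n)"
    unfolding gradient_on_def by (intro closure_minimal hull_minimal closed UN_least convex_convex_hull)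
  moreover have "convex hull (\<Inter>n. G n) \<subseteq> gradient_on f (cball x \<epsilon>)"
  proof -
    have "(\<Inter>n. G n) \<subseteq> (\<Union>y\<in>cball x \<epsilon>. clarke_gradient f y)"
    proof
      fix D assume "D \<in> (\<Inter>n. G n)"
      then have "D \<in> closure (derivatives_on f (cball x (\<epsilon> + inverse (real (Suc n)))))" for n
        unfolding G_def by (rule INT_D) simp
      from derivative_limit_in_clarke_gradient[OF \<open>\<epsilon> \<ge> 0\<close> this]
      show "D \<in> (\<Union>y\<in>cball x \<epsilon>. clarke_gradient f y)" by (simp only: UN_iff)
    qed
    then show ?thesis
      unfolding gradient_on_def by (rule order_trans[OF hull_mono closure_subset])
  qed
  ultimately have "convex hull (\<Inter>n. G n) = gradient_on f (cball x \<epsilon>)" by (rule equalityI[rotated])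
  then show ?thesis unfolding goldstein_gradient_altdef G_def .
qed

section \<open>Reduction to globally Lipschitz functions\<close>

lemma locally_lipschitz_imp_lipschitz_on_compact:
  fixes f :: "'a::metric_space \<Rightarrow> 'b::metric_space"
  assumes "locally_lipschitz f" "compact K"
  obtains L where "L-lipschitz_on K f"
proof -
  \<comment> \<open>Treating \<open>f\<close> as a family over a one-point time set makes the
    compactness theorem for \<open>local_lipschitz\<close> applicable.\<close>
  have "local_lipschitz {0::real} K (\<lambda>_. f)"
    unfolding local_lipschitz_def
  proof (intro ballI)
    fix x t assume "x \<in> K"
    obtain u L where "u > 0" "L-lipschitz_on (cball x u) f"
      using assms(1) unfolding locally_lipschitz_def by blast
    then show "\<exists>u>0. \<exists>L. \<forall>t\<in>cball t u \<inter> {0}. L-lipschitz_on (cball x u \<inter> K) f"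
      by (auto intro: lipschitz_on_subset)
  qed
  then obtain L where "\<And>t. t \<in> {0::real} \<Longrightarrow> L-lipschitz_on K f"
    by (rule local_lipschitz_compact_implies_lipschitz) (use assms(2) in auto)
  then show ?thesis using that by blast
qed

lemma clarke_gradient_cong:
  assumes "open U" "y \<in> U" "\<And>z. z \<in> U \<Longrightarrow> f z = g z"
  shows "clarke_gradient f y = clarke_gradient g y"
proof -
  have "clarke_dderiv f y h = clarke_dderiv g y h" for h
    unfolding clarke_dderiv_def
  proof (rule Limsup_eq)
    have "((\<lambda>(z, t). z + t *\<^sub>R h) \<longlongrightarrow> y + 0 *\<^sub>R h) (nhds y \<times>\<^sub>F at_right 0)"
      unfolding case_prod_beta'
      by (intro tendsto_intros filterlim_fst[THEN filterlim_compose[rotated]] filterlim_compose[OF _ filterlim_snd]) (auto simp: tendsto_ident_at filterlim_ident)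
    then have "\<forall>\<^sub>F p in nhds y \<times>\<^sub>F at_right 0. (\<lambda>(z, t). z + t *\<^sub>R h) p \<in> U"
      using assms(1,2) by (intro topological_tendstoD) auto
    moreover have "\<forall>\<^sub>F p in nhds y \<times>\<^sub>F at_right (0::real). fst p \<in> U"
      by (rule eventually_compose_filterlim[OF eventually_nhds_in_open[OF assms(1,2)] filterlim_fst])
    ultimately show "\<forall>\<^sub>F p in nhds y \<times>\<^sub>F at_right 0. (case p of (z, t) \<Rightarrow> ereal ((f (z + t *\<^sub>R h) - f z) / t)) =
        (case p of (z, t) \<Rightarrow> ereal ((g (z + t *\<^sub>R h) - g z) / t))"
      by eventually_elim (auto simp: assms(3))
  qed
  then show ?thesis by (simp add: clarke_gradient_def)
qed

lemma derivatives_on_cong: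
  assumes "open U" "A \<subseteq> U" "\<And>z. z \<in> U \<Longrightarrow> f z = g z"
  shows "derivatives_on f A = derivatives_on g A"
proof -
  have "(f has_derivative D) (at y) \<longleftrightarrow> (g has_derivative D) (at y)" if "y \<in> U" for y D
    using has_derivative_transform_within_open[OF _ assms(1) that] assms(3) by metis
  then show ?thesis using assms(2) by (auto simp: derivatives_on_def)
qed

theorem corollary2p13:
  fixes f :: "real ^ 'n \<Rightarrow> real"
  assumes "locally_lipschitz f"
  shows "\<forall>x. \<forall>\<epsilon>\<ge>0. goldstein_gradient \<epsilon> f x = gradient_on f (cball x \<epsilon>)"
proof (intro allI impI)
  fix x :: "real ^ 'n" and \<epsilon> :: real assume "\<epsilon> \<ge> 0"
  \<comment> \<open>The largest ball in Goldstein's intersection has radius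
    \<open>\<epsilon> + 1\<close>, and it must lie in an open set on which \<open>f\<close> and
    \<open>g\<close> agree.\<close>
  let ?K = "cball x (\<epsilon> + 2)" and ?U = "ball x (\<epsilon> + 2)"
  \<comment> \<open>Projection onto a closed convex set is nonexpansive, so \<open>g\<close> is
    globally Lipschitz with the constant of \<open>f\<close> on \<open>?K\<close>.\<close>
  define g where "g = f \<circ> closest_point ?K"
  obtain L where L: "L-lipschitz_on ?K f"
    using locally_lipschitz_imp_lipschitz_on_compact[OF assms compact_cball] .
  have ne: "?K \<noteq> {}" using \<open>\<epsilon> \<ge> 0\<close> by simp
  have "1-lipschitz_on UNIV (closest_point ?K)"
    using closest_point_lipschitz[OF convex_cball closed_cball ne] by (intro lipschitz_onI) auto
  then have g: "(L * 1)-lipschitz_on UNIV g"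
    unfolding g_def
    by (rule lipschitz_on_compose) (rule lipschitz_on_subset[OF L], use closest_point_in_set[OF closed_cball ne] in blast)
  have fg: "f z = g z" if "z \<in> ?U" for z
    using that by (simp add: g_def closest_point_self)
  have "cball x (\<epsilon> + inverse (real (Suc n))) \<subseteq> ?U" for n
  proof -
    have "inverse (real (Suc n)) \<le> 1" by (simp add: inverse_le_1_iff)
    then show ?thesis by (auto simp del: of_nat_Suc)
  qed
  then have "derivatives_on f (cball x (\<epsilon> + inverse (real (Suc n)))) = derivatives_on g (cball x (\<epsilon> + inverse (real (Suc n))))" for n
    by (rule derivatives_on_cong[OF open_ball _ fg])
  then have "goldstein_gradient \<epsilon> f x = goldstein_gradient \<epsilon> g x"
    unfolding goldstein_gradient_altdef by (simp del: of_nat_Suc)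
  also have "\<dots> = gradient_on g (cball x \<epsilon>)"
    by (rule goldstein_gradient_eq_gradient_on_lipschitz[OF g \<open>\<epsilon> \<ge> 0\<close>])
  also have "\<dots> = gradient_on f (cball x \<epsilon>)"
  proof -
    have "clarke_gradient f y = clarke_gradient g y" if "y \<in> cball x \<epsilon>" for y
      by (rule clarke_gradient_cong[OF open_ball _ fg]) (use that in auto)
    then show ?thesis by (simp add: gradient_on_def)
  qed
  finally show "goldstein_gradient \<epsilon> f x = gradient_on f (cball x \<epsilon>)" .
qed

end
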